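(* Consider the PVRD$^2$ algorithm with pipeline depth $J\ge 1$ and constant step-size $\mu>0$, as defined in the context, under the standing assumptions listed there. There exists $\bar\mu>0$ such that for every step-size $0<\mu\le\bar\mu$ there is a constant $C<\infty$ (independent of $i$) with $$\mathbb{E}\,\|w_{i,k}-w^\star_k\|^2\le \rho^i C\qquad\text{for all agents }k\text{ and all } i>0,$$ where $w^\star=\mathrm{col}\{w_1^\star,\dots,w_K^\star\}$ is the minimizer of $R$, the expectation is over the random sample indices, and $$\rho=\max\Big(1-\frac{1-\lambda^J}{2N},\;1-\frac{\mu\nu}{5}\Big).$$
   Context: Data and risk. There are $N$ data pairs $(h_n,\gamma_n)$, $n=1,\dots,N$, with $h_n\in\mathbb{R}^M$ and scalar labels $\gamma_n$. The feature vector and the parameter are partitioned into $K$ blocks, $h_n=\mathrm{col}\{h_{n,1},\dots,h_{n,K}\}$, $w=\mathrm{col}\{w_1,\dots,w_K\}$ with $h_{n,k},w_k\in\mathbb{R}^{M_k}$, $\sum_k M_k=M$; block $k$ is held by agent $k$. The empirical risk is $$R(w)=\frac1N\sum_{n=1}^N Q\Big(\sum_{k=1}^K h_{n,k}^{\mathsf T}w_k;\gamma_n\Big)+\sum_{k=1}^K r_k(w_k),$$ where $Q(\cdot;\gamma):\mathbb{R}\to\mathbb{R}$ is differentiable with derivative $\nabla_z Q(z;\gamma)$, and $r(w)=\sum_k r_k(w_k)$. Assumptions. (i) For every $n$, the map $w\mapsto Q(h_n^{\mathsf T}w;\gamma_n)$ has $L$-Lipschitz gradient, i.e. $\|\nabla_zQ(h_n^{\mathsf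 T}w_1;\gamma_n)h_n-\nabla_zQ(h_n^{\mathsf T}w_2;\gamma_n)h_n\|\le L\|w_1-w_2\|$, and $|\nabla_zQ(z_1;\gamma_n)-\nabla_zQ(z_2;\gamma_n)|\le\delta|z_1-z_2|$ for all $z_1,z_2$, with $L,\delta>0$. (ii) $r$ is convex with $\eta$-Lipschitz gradient. (iii) $R$ is $\nu$-strongly convex: $(\nabla R(w_1)-\nabla R(w_2))^{\mathsf T}(w_1-w_2)\ge\nu\|w_1-w_2\|^2$; $w^\star$ denotes its unique minimizer. (iv) Agents communicate over a strongly connected graph with combination matrix $A=[a_{\ell k}]\in\mathbb{R}^{K\times K}$, nonnegative, with $a_{\ell k}>0$ only if $\ell=k$ or $\ell$ is a neighbor of $k$ ($\ell\in\mathcal N_k$, where $\mathcal N_k$ includes $k$), $A=A^{\mathsf T}$, $A\mathbf 1_K=\mathbf 1_K$, and $a_{kk}>0$ for at least one $k$. $\lambda\in(0,1)$ denotes the second largest magnitude of the eigenvalues of $A$. PVRD$^2$ algorithm (pipelined variance-reduced dynamic diffusion). Each agent $k$ stores $w_{i,k}$ and scalar tables $u^i_{n,k},v^i_{n,k}$, $n=1,\dots,N$, initialized $w_{1,k}=0$ (equivalently $w_{0,k}=0$), $u^1_{n,k}=v^1_{n,k}=0$. At each iteration $i=1,2,\dots$ an index $n_i$ is drawn uniformly from $\{1,\dots,N\}$, independently of the past, and the same $n_i$ is used by all agents. Agent $k$ forms $z^{(0)}_{n_i,k}=u^i_{n_i,k}+Kh_{n_i,k}^{\mathsf T}w_{i,k}-v^i_{n_i,k}$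 and records $p_{i,k}=Kh_{n_i,k}^{\mathsf T}w_{i,k}$. Pipeline: at iteration $i$, for each $j=0,\dots,J-1$ with $i-j\ge1$, agents compute $z^{(j+1)}_{n_{i-j},k}=\sum_{\ell\in\mathcal N_k}a_{\ell k}z^{(j)}_{n_{i-j},\ell}$ (one communication of a length-$J$ vector per iteration). For $i\ge J$, let $n'_i=n_{i-J+1}$ and update $$w_{i+1,k}=w_{i,k}-\mu\Big\{\big[\nabla_zQ(z^{(J)}_{n'_i,k};\gamma_{n'_i})-\nabla_zQ(u^i_{n'_i,k};\gamma_{n'_i})\big]h_{n'_i,k}+\frac1N\sum_{n=1}^N\nabla_zQ(u^i_{n,k};\gamma_n)h_{n,k}+\nabla r_k(w_{i,k})\Big\},$$ then set $u^{i+1}_{n'_i,k}=z^{(J)}_{n'_i,k}$, $v^{i+1}_{n'_i,k}=p_{i-J+1,k}$, and $u^{i+1}_{n,k}=u^i_{n,k}$, $v^{i+1}_{n,k}=v^i_{n,k}$ for $n\ne n'_i$. (During the warm-up iterations $i<J$ no quantity has yet exited the pipeline; $w$ and the tables are left unchanged.) *)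

theory Defs
  imports "HOL-Analysis.Analysis" "HOL-Computational_Algebra.Polynomial" "HOL-Library.Multiset"
begin

definition charpoly :: "real^'k^'k \<Rightarrow> real poly" where
  "charpoly A = det (\<chi> i j. (if i = j then [:0, 1:] else 0) - [:A$i$j:])"

(* Second largest magnitude among the eigenvalues (counted with multiplicity) of a
   real matrix whose eigenvalues are all real (e.g. a symmetric matrix):
   sort the magnitudes of the roots of the characteristic polynomial increasingly
   and take the second to last one. *)
definition second_largest_eig_mag :: "real^'k^'k \<Rightarrow> real" where
  "second_largest_eig_mag A =
     (let xs = sort (map abs (sorted_list_of_multiset (proots (charpoly A))))
      in xs ! (length xs - 2))"

(* Block structure: blk j = agent holding coordinate j of R^M.
   Local vectors of agent k (elements of R^{M_k}) are represented as vectors of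
   real^'m supported on the coordinates {j. blk j = k}. *)
definition blkdot :: "('m::finite \<Rightarrow> 'k) \<Rightarrow> 'k \<Rightarrow> real^'m \<Rightarrow> real^'m \<Rightarrow> real" where
  "blkdot blk k x y = (\<Sum>j\<in>{j. blk j = k}. x$j * y$j)"

definition blkvec :: "('m::finite \<Rightarrow> 'k) \<Rightarrow> 'k \<Rightarrow> real^'m \<Rightarrow> real^'m" where
  "blkvec blk k x = (\<chi> j. if blk j = k then x$j else 0)"

definition blknorm2 :: "('m::finite \<Rightarrow> 'k) \<Rightarrow> 'k \<Rightarrow> real^'m \<Rightarrow> real^'m \<Rightarrow> real" where
  "blknorm2 blk k x y = (\<Sum>j\<in>{j. blk j = k}. (x$j - y$j)^2)"

(* state at the beginning of iteration i: (w_{i,k}, u^i_{n,k}, v^i_{n,k}) *)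
type_synonym ('m,'k,'n) pvrd_state =
  "('k \<Rightarrow> real^'m) \<times> ('k \<Rightarrow> 'n \<Rightarrow> real) \<times> ('k \<Rightarrow> 'n \<Rightarrow> real)"

definition pvrd_init :: "('m::finite,'k,'n) pvrd_state" where
  "pvrd_init = ((\<lambda>k. 0), (\<lambda>k n. 0), (\<lambda>k n. 0))"

definition combine :: "real^'k^'k \<Rightarrow> ('k::finite \<Rightarrow> real) \<Rightarrow> 'k \<Rightarrow> real" where
  "combine A z k = (\<Sum>l\<in>UNIV. A$l$k * z l)"

definition pvrd_z0 :: "('m::finite \<Rightarrow> 'k::finite) \<Rightarrow> ('n \<Rightarrow> real^'m) \<Rightarrow> 'n
     \<Rightarrow> ('m,'k,'n) pvrd_state \<Rightarrow> 'k \<Rightarrow> real" where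
  "pvrd_z0 blk h n S k =
     (case S of (W, U, V) \<Rightarrow> U k n + real CARD('k) * blkdot blk k (h n) (W k) - V k n)"

definition pvrd_p :: "('m::finite \<Rightarrow> 'k::finite) \<Rightarrow> ('n \<Rightarrow> real^'m) \<Rightarrow> 'n
     \<Rightarrow> ('m,'k,'n) pvrd_state \<Rightarrow> 'k \<Rightarrow> real" where
  "pvrd_p blk h n S k = (case S of (W, U, V) \<Rightarrow> real CARD('k) * blkdot blk k (h n) (W k))"

(* state at iteration i+1 from state S at iteration i and state S' at iteration
   s = i - J + 1 (when the sample n_s = n' exits the pipeline) *)
definition pvrd_next :: "real^'k^'k \<Rightarrow> ('m::finite \<Rightarrow> 'k::finite) \<Rightarrow> ('n::finite \<Rightarrow> real^'m)
     \<Rightarrow> ('n \<Rightarrow> real) \<Rightarrow> (real \<Rightarrow> real \<Rightarrow> real) \<Rightarrow> ('k \<Rightarrow> real^'m \<Rightarrow> real^'m)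
     \<Rightarrow> nat \<Rightarrow> real \<Rightarrow> 'n \<Rightarrow> ('m,'k,'n) pvrd_state \<Rightarrow> ('m,'k,'n) pvrd_state
     \<Rightarrow> ('m,'k,'n) pvrd_state" where
  "pvrd_next A blk h \<gamma> dQ gr J \<mu> n' S S' =
     (case S of (W, U, V) \<Rightarrow>
       (let zJ = (combine A ^^ J) (pvrd_z0 blk h n' S');
            p = pvrd_p blk h n' S'
        in ((\<lambda>k. W k - \<mu> *\<^sub>R
                 ((dQ (zJ k) (\<gamma> n') - dQ (U k n') (\<gamma> n')) *\<^sub>R blkvec blk k (h n')
                  + (1 / real CARD('n)) *\<^sub>R (\<Sum>n\<in>UNIV. dQ (U k n) (\<gamma> n) *\<^sub>R blkvec blk k (h n))
                  + gr k (W k))),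
            (\<lambda>k. (U k)(n' := zJ k)),
            (\<lambda>k. (V k)(n' := p k)))))"

(* pvrd_hist A blk h \<gamma> dQ gr J \<mu> ns m i = state at iteration i, valid for 1 <= i <= m+1;
   ns s is the sample index n_s drawn at iteration s (s >= 1). *)
primrec pvrd_hist :: "real^'k^'k \<Rightarrow> ('m::finite \<Rightarrow> 'k::finite) \<Rightarrow> ('n::finite \<Rightarrow> real^'m)
     \<Rightarrow> ('n \<Rightarrow> real) \<Rightarrow> (real \<Rightarrow> real \<Rightarrow> real) \<Rightarrow> ('k \<Rightarrow> real^'m \<Rightarrow> real^'m)
     \<Rightarrow> nat \<Rightarrow> real \<Rightarrow> (nat \<Rightarrow> 'n) \<Rightarrow> nat \<Rightarrow> nat \<Rightarrow> ('m,'k,'n) pvrd_state" where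
  "pvrd_hist A blk h \<gamma> dQ gr J \<mu> ns 0 = (\<lambda>i. pvrd_init)"
| "pvrd_hist A blk h \<gamma> dQ gr J \<mu> ns (Suc m) =
     (let H = pvrd_hist A blk h \<gamma> dQ gr J \<mu> ns m; i = Suc m in
      H(Suc i := (if i < J then H i
                  else pvrd_next A blk h \<gamma> dQ gr J \<mu> (ns (i - J + 1)) (H i) (H (i - J + 1)))))"

definition pvrd_w :: "real^'k^'k \<Rightarrow> ('m::finite \<Rightarrow> 'k::finite) \<Rightarrow> ('n::finite \<Rightarrow> real^'m)
     \<Rightarrow> ('n \<Rightarrow> real) \<Rightarrow> (real \<Rightarrow> real \<Rightarrow> real) \<Rightarrow> ('k \<Rightarrow> real^'m \<Rightarrow> real^'m)
     \<Rightarrow> nat \<Rightarrow> real \<Rightarrow> (nat \<Rightarrow> 'n) \<Rightarrow> nat \<Rightarrow> 'k \<Rightarrow> real^'m" where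
  "pvrd_w A blk h \<gamma> dQ gr J \<mu> ns i k = fst (pvrd_hist A blk h \<gamma> dQ gr J \<mu> ns i i) k"

(* Expectation over i.i.d. uniform indices n_1, ..., n_i of a quantity depending
   only on these indices: uniform average over all sample paths. *)
definition expect_paths :: "nat \<Rightarrow> ((nat \<Rightarrow> 'n::finite) \<Rightarrow> real) \<Rightarrow> real" where
  "expect_paths i f = (\<Sum>ns\<in>PiE {1..i} (\<lambda>_. UNIV). f ns) / real CARD('n) ^ i"

end

theory Submission
  imports Defs
begin

text \<open>
  The bound already holds with \<open>1 - \<mu> \<nu> / 5\<close> in place of \<open>\<rho>\<close>. Of the combination matrix only
  one fact is needed: it contracts the zero-sum vectors by some factor \<open>\<theta> < 1\<close>, since the maximal
  stretch of a zero-sum vector is the magnitude of an eigenvalue whose eigenvector is orthogonal to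
  the constant vector.

  Three squared errors are tracked: the distance \<open>a\<close> of the weights to the minimizer, the
  deviation \<open>b\<close> of the \<open>u\<close> tables from network consensus, and the lag \<open>d\<close> of the \<open>v\<close> tables
  behind the current predictions. The sums over agents of the \<open>u\<close> and \<open>v\<close> tables always agree,
  so the network mean of a value leaving the pipeline is an exact though delayed prediction. The
  leaving sample is independent of the current state, hence the mean update is the gradient of the
  risk up to errors of size \<open>b + d\<close> and the delay. In expectation \<open>a\<close> contracts at rate
  \<open>1 - \<mu> \<nu>\<close> with input \<open>\<mu> (b + d)\<close>, \<open>b\<close> contracts at a fixed rate with input \<open>d\<close>, and \<open>d\<close>
  contracts at a fixed rate with input \<open>\<mu>\<^sup>2\<close> times the recent errors, because the weights move
  by \<open>O(\<mu>)\<close> per iteration. The total gain around this loop vanishes with \<open>\<mu>\<close>.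
\<close>

section \<open>Eigenvalues of the combination matrix\<close>

lemma det_const_poly:
  fixes P :: "real^'k^'k"
  shows "det (\<chi> i j. [:P$i$j:]) = [:det P:]"
proof -
  have "(\<Prod>i\<in>UNIV. [:f i:]) = [:\<Prod>i\<in>UNIV. f i:]" for f :: "'k \<Rightarrow> real"
    using finite_class.finite_UNIV by (induction rule: finite_induct) (auto simp: one_pCons)
  then show ?thesis
    by (simp add: det_def of_int_poly mult.commute flip: sum_to_poly)
qed

lemma poly_charpoly: "poly (charpoly A) t = det (mat t - A)"
  unfolding charpoly_def det_def
  by (auto simp: poly_sum poly_prod mat_def intro!: sum.cong prod.cong)

lemma mat_mult_vector: "mat t *v x = t *\<^sub>R x" for x :: "real^'k"
  by (simp add: vec_eq_iff matrix_vector_mult_def mat_def if_distrib[of "\<lambda>c. c * _"] cong: if_cong)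

lemma eigenvector_of_charpoly_root:
  fixes A :: "real^'k^'k"
  assumes "poly (charpoly A) t = 0"
  obtains x where "x \<noteq> 0" "A *v x = t *\<^sub>R x"
proof -
  have "\<not> invertible (mat t - A)"
    using assms by (simp add: poly_charpoly invertible_det_nz)
  then obtain x where "x \<noteq> 0" "(mat t - A) *v x = 0"
    unfolding invertible_left_inverse matrix_left_invertible_ker by blast
  then show thesis
    using that by (simp add: matrix_vector_mult_diff_rdistrib mat_mult_vector)
qed

lemma charpoly_nonzero: "charpoly A \<noteq> 0"
proof
  assume "charpoly A = 0"
  define t where "t = onorm ((*v) A) + 1"
  have bounded: "bounded_linear ((*v) A)"
    by (simp add: linear_linear)
  obtain x where "x \<noteq> 0" and eigen: "A *v x = t *\<^sub>R x"
    using eigenvector_of_charpoly_root[of A t] \<open>charpoly A = 0\<close> by auto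
  have "\<bar>t\<bar> * norm x \<le> onorm ((*v) A) * norm x"
    using onorm[OF bounded, of x] by (simp add: eigen)
  then show False
    using \<open>x \<noteq> 0\<close> onorm_pos_le[OF bounded] by (simp add: t_def)
qed

lemma independent_subset_of_invertible_columns:
  fixes S :: "(real^'k) set"
  assumes "independent S"
  obtains b :: "'k \<Rightarrow> real^'k" where "inj b" "S \<subseteq> range b" "invertible (\<chi> i j. b j $ i)"
proof -
  obtain B where B: "S \<subseteq> B" "B \<subseteq> UNIV" "independent B" "UNIV \<subseteq> span B"
    using maximal_independent_subset_extend[OF subset_UNIV assms] .
  have "card B = CARD('k)"
    using basis_card_eq_dim[of B UNIV] B by simp
  then obtain b :: "'k \<Rightarrow> real^'k" where b: "bij_betw b UNIV B"
    using finite_same_card_bij[of "UNIV :: 'k set" B] independent_imp_finite[OF B(3)] by auto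
  have "columns (\<chi> i j. b j $ i) = B"
    using bij_betw_imp_surj_on[OF b] by (auto simp: columns_def column_def)
  then have "invertible (\<chi> i j. b j $ i)"
    using B(4) unfolding invertible_right_inverse matrix_right_invertible_span_columns
    by (simp add: span_vec_eq top.extremum_unique)
  then show thesis
    using b B(1) by (intro that) (auto simp: bij_betw_def)
qed

text \<open>In a basis containing \<open>S\<close>, the column of \<open>t I - A\<close> that belongs to an eigenvector
  is \<open>t - e\<close> times a constant column, and these factors can be pulled out of the determinant.\<close>

lemma prod_eigenvalue_factors_dvd_charpoly:
  fixes A :: "real^'k^'k"
  assumes "independent S" and eigen: "\<And>x. x \<in> S \<Longrightarrow> A *v x = e x *\<^sub>R x"
  shows "(\<Prod>x\<in>S. [:- e x, 1:]) dvd charpoly A"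
proof -
  obtain b :: "'k \<Rightarrow> real^'k" where b: "inj b" "S \<subseteq> range b" "invertible (\<chi> i j. b j $ i)"
    using independent_subset_of_invertible_columns[OF assms(1)] .
  define P :: "real^'k^'k" where "P = (\<chi> i j. b j $ i)"
  define M :: "real poly^'k^'k" where "M = (\<chi> i j. (if i = j then [:0, 1:] else 0) - [:A$i$j:])"
  define MP where "MP = M ** (\<chi> i j. [:P$i$j:])"
  define c where "c j = (if b j \<in> S then [:- e (b j), 1:] else 1)" for j
  define T where "T j = (if b j \<in> S then \<chi> i. [:b j $ i:] else \<chi> i. MP$i$j)" for j
  have "MP$i$j = [:- e (b j), 1:] * [:b j $ i:]" if "b j \<in> S" for i j
  proof -
    have "MP$i$j = (\<Sum>l\<in>UNIV. (if i = l then [:0, b j $ l:] else 0) - [:A$i$l * b j $ l:])"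
      unfolding MP_def M_def P_def matrix_matrix_mult_def by (auto intro!: sum.cong)
    also have "\<dots> = [:0, b j $ i:] - [:(A *v b j) $ i:]"
      by (simp add: sum_subtractf sum_to_poly matrix_vector_mult_def)
    finally show ?thesis
      by (simp add: eigen[OF that])
  qed
  then have "transpose MP = (\<chi> j. c j *s T j)"
    by (auto simp: transpose_def vec_eq_iff c_def T_def)
  then have "det MP = prod c UNIV * det (\<chi> j. T j)"
    by (metis det_rows_mul det_transpose)
  moreover have "prod c UNIV = (\<Prod>x\<in>S. [:- e x, 1:])"
  proof -
    have "prod c UNIV = (\<Prod>x\<in>range b. if x \<in> S then [:- e x, 1:] else 1)"
      using b(1) by (simp add: prod.reindex c_def)
    then show ?thesis
      using b(2) by (simp add: prod.If_cases Int_absorb1)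
  qed
  moreover have "det MP = smult (det P) (charpoly A)"
    by (simp add: MP_def det_mul det_const_poly charpoly_def M_def)
  ultimately have "(\<Prod>x\<in>S. [:- e x, 1:]) dvd smult (det P) (charpoly A)"
    by (metis dvd_triv_left)
  moreover have "det P \<noteq> 0"
    using b(3) by (simp add: P_def invertible_det_nz)
  ultimately show ?thesis
    by (rule dvd_smult_cancel)
qed

lemma eigenvalues_subset_proots_charpoly:
  fixes A :: "real^'k^'k"
  assumes "independent S" and "\<And>x. x \<in> S \<Longrightarrow> A *v x = e x *\<^sub>R x"
  shows "image_mset e (mset_set S) \<subseteq># proots (charpoly A)"
proof -
  obtain q where q: "charpoly A = (\<Prod>x\<in>S. [:- e x, 1:]) * q"
    using prod_eigenvalue_factors_dvd_charpoly[OF assms] by (rule dvdE)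
  then have "proots (charpoly A) = proots (\<Prod>x\<in>S. [:- e x, 1:]) + proots q"
    using charpoly_nonzero[of A] by (auto simp: proots_mult)
  also have "proots (\<Prod>x\<in>S. [:- e x, 1:]) = (\<Sum>x\<in>S. {#e x#})"
    by (subst proots_prod) auto
  also have "\<dots> = image_mset e (mset_set S)"
    by (simp add: sum_unfold_sum_mset)
  finally show ?thesis
    by simp
qed

lemma sorted_nth_from_end_ge:
  fixes xs :: "'a::linorder list"
  assumes "sorted xs" and "0 < k" "k \<le> length (filter (\<lambda>x. c \<le> x) xs)"
  shows "c \<le> xs ! (length xs - k)"
proof (rule ccontr)
  assume below: "\<not> ?thesis"
  have "k \<le> length xs"
    using assms(3) length_filter_le order_trans by blast
  have "length xs - k < i" if "i < length xs" "c \<le> xs ! i" for i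
    using sorted_nth_mono[OF assms(1), of i "length xs - k"] that below assms(2) \<open>k \<le> length xs\<close>
    by (meson diff_less not_less order.strict_trans1 order_trans)
  then have "{i. i < length xs \<and> c \<le> xs ! i} \<subseteq> {length xs - k<..<length xs}"
    by auto
  then have "length (filter (\<lambda>x. c \<le> x) xs) \<le> card {length xs - k<..<length xs}"
    unfolding length_filter_conv_card by (intro card_mono) auto
  then show False
    using assms(2,3) \<open>k \<le> length xs\<close> by simp
qed

lemma second_largest_eig_mag_ge:
  fixes A :: "real^'k^'k"
  assumes "independent S" and eigen: "\<And>x. x \<in> S \<Longrightarrow> A *v x = e x *\<^sub>R x"
    and "2 \<le> card S" and large: "\<And>x. x \<in> S \<Longrightarrow> c \<le> \<bar>e x\<bar>"
  shows "c \<le> second_largest_eig_mag A"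
proof -
  let ?xs = "sort (map abs (sorted_list_of_multiset (proots (charpoly A))))"
  have "mset (filter (\<lambda>x. c \<le> x) ?xs) =
      filter_mset (\<lambda>x. c \<le> x) (image_mset abs (proots (charpoly A)))"
    by simp
  moreover have "image_mset (\<lambda>x. \<bar>e x\<bar>) (mset_set S) \<subseteq># image_mset abs (proots (charpoly A))"
    using image_mset_subseteq_mono[OF eigenvalues_subset_proots_charpoly[OF assms(1) eigen], of abs]
    by (simp add: multiset.map_comp o_def)
  then have "filter_mset (\<lambda>x. c \<le> x) (image_mset (\<lambda>x. \<bar>e x\<bar>) (mset_set S)) \<subseteq>#
      filter_mset (\<lambda>x. c \<le> x) (image_mset abs (proots (charpoly A)))"
    by (rule multiset_filter_mono)
  moreover have "filter_mset (\<lambda>x. c \<le> x) (image_mset (\<lambda>x. \<bar>e x\<bar>) (mset_set S)) =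
      image_mset (\<lambda>x. \<bar>e x\<bar>) (mset_set S)"
    using large independent_imp_finite[OF assms(1)] by (auto simp: filter_mset_eq_conv)
  ultimately have "card S \<le> length (filter (\<lambda>x. c \<le> x) ?xs)"
    by (metis size_image_mset size_mset size_mset_mono size_mset_set)
  then have "c \<le> ?xs ! (length ?xs - 2)"
    using \<open>2 \<le> card S\<close> by (intro sorted_nth_from_end_ge) auto
  then show ?thesis
    by (simp add: second_largest_eig_mag_def Let_def)
qed


lemma operator_norm_attained_on_subspace:
  fixes f :: "'a::euclidean_space \<Rightarrow> 'b::real_normed_vector"
  assumes f: "bounded_linear f" and S: "subspace S" "S \<noteq> {0}"
  obtains x0 where "x0 \<in> S" "norm x0 = 1" "\<And>x. x \<in> S \<Longrightarrow> norm (f x) \<le> norm (f x0) * norm x"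
proof -
  interpret f: bounded_linear f
    by (rule f)
  obtain x1 where "x1 \<in> S" "x1 \<noteq> 0"
    using S subspace_0 by blast
  then have "(1 / norm x1) *\<^sub>R x1 \<in> S \<inter> sphere 0 1"
    using S(1) by (simp add: subspace_scale)
  moreover have "compact (S \<inter> sphere 0 1)"
    by (intro closed_Int_compact closed_subspace S(1)) auto
  moreover have "continuous_on (S \<inter> sphere 0 1) (\<lambda>x. norm (f x))"
    by (intro continuous_intros f.continuous_on)
  ultimately obtain x0 where x0: "x0 \<in> S \<inter> sphere 0 1"
    and max: "\<And>x. x \<in> S \<inter> sphere 0 1 \<Longrightarrow> norm (f x) \<le> norm (f x0)"
    using continuous_attains_sup[of "S \<inter> sphere 0 1" "\<lambda>x. norm (f x)"] by blast
  have "norm (f x) \<le> norm (f x0) * norm x" if "x \<in> S" for x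
  proof (cases "x = 0")
    case False
    then have "norm (f ((1 / norm x) *\<^sub>R x)) \<le> norm (f x0)"
      using S(1) that by (intro max) (simp add: subspace_scale)
    then show ?thesis
      using False by (simp add: f.scaleR divide_simps)
  qed (simp add: f.zero)
  with x0 show thesis
    by (intro that) auto
qed

lemma inner_symmetric_matrix:
  fixes A :: "real^'k^'k"
  assumes "transpose A = A"
  shows "(A *v x) \<bullet> y = x \<bullet> (A *v y)"
  by (metis assms dot_lmul_matrix transpose_matrix_vector)

text \<open>At a unit vector \<open>x\<close> of maximal stretch \<open>\<theta>\<close> the Cauchy-Schwarz inequality
  \<open>\<theta>\<^sup>2 = x \<bullet> A\<^sup>2 x \<le> norm (A\<^sup>2 x) \<le> \<theta>\<^sup>2\<close> is an equality.\<close>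

lemma square_norm_maximizer_eigenvector:
  fixes A :: "real^'k^'k"
  assumes sym: "transpose A = A" and "norm x = 1"
    and stretch: "norm (A *v (A *v x)) \<le> (norm (A *v x))\<^sup>2"
  shows "A *v (A *v x) = (norm (A *v x))\<^sup>2 *\<^sub>R x"
proof -
  let ?t = "(norm (A *v x))\<^sup>2"
  have "(norm (A *v (A *v x) - ?t *\<^sub>R x))\<^sup>2 =
      (norm (A *v (A *v x)))\<^sup>2 - 2 * ?t * ((A *v (A *v x)) \<bullet> x) + ?t\<^sup>2 * (x \<bullet> x)"
    unfolding power2_norm_eq_inner[of "_ - _"] power2_norm_eq_inner[of "A *v (A *v x)"]
    by (simp add: inner_diff inner_commute power2_eq_square algebra_simps)
  also have "(A *v (A *v x)) \<bullet> x = ?t"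
    by (simp add: inner_symmetric_matrix[OF sym] power2_norm_eq_inner)
  also have "x \<bullet> x = 1"
    using \<open>norm x = 1\<close> by (simp add: norm_eq_1)
  also have "(norm (A *v (A *v x)))\<^sup>2 \<le> ?t\<^sup>2"
    by (intro power_mono stretch) simp
  finally have "(norm (A *v (A *v x) - ?t *\<^sub>R x))\<^sup>2 \<le> 0"
    by (simp add: power2_eq_square)
  then show ?thesis
    by simp
qed

lemma symmetric_matrix_extremal_eigenvector:
  fixes A :: "real^'k^'k"
  assumes sym: "transpose A = A" and S: "subspace S" "S \<noteq> {0}"
    and invariant: "\<And>x. x \<in> S \<Longrightarrow> A *v x \<in> S"
  obtains y b where "y \<in> S" "y \<noteq> 0" "A *v y = b *\<^sub>R y"
    "\<And>x. x \<in> S \<Longrightarrow> norm (A *v x) \<le> \<bar>b\<bar> * norm x"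
proof -
  have "bounded_linear ((*v) A)"
    by (simp add: linear_linear)
  then obtain x where x: "x \<in> S" "norm x = 1"
    and bound: "\<And>z. z \<in> S \<Longrightarrow> norm (A *v z) \<le> norm (A *v x) * norm z"
    using operator_norm_attained_on_subspace[OF _ S] by blast
  define \<theta> where "\<theta> = norm (A *v x)"
  have square: "A *v (A *v x) = \<theta>\<^sup>2 *\<^sub>R x"
    unfolding \<theta>_def using bound[OF invariant[OF x(1)]]
    by (intro square_norm_maximizer_eigenvector sym x) (simp add: power2_eq_square)
  define y where "y = A *v x + \<theta> *\<^sub>R x"
  show thesis
  proof (cases "y = 0")
    case True
    then have "A *v x = (- \<theta>) *\<^sub>R x"
      by (simp add: y_def eq_neg_iff_add_eq_0)
    then show ?thesis
      using x bound by (intro that[of x "- \<theta>"]) (auto simp: \<theta>_def)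
  next
    case False
    have "A *v y = \<theta> *\<^sub>R y"
      by (simp add: y_def matrix_vector_right_distrib matrix_vector_mult_scaleR square
          power2_eq_square scaleR_right_distrib)
    moreover have "y \<in> S"
      using invariant x(1) S(1) by (simp add: y_def subspace_add subspace_scale)
    ultimately show ?thesis
      using False bound by (intro that[of y \<theta>]) (auto simp: \<theta>_def)
  qed
qed

lemma symmetric_stochastic_contraction:
  fixes A :: "real^'k^'k"
  assumes sym: "transpose A = A" and stoch: "A *v 1 = 1"
    and gap: "second_largest_eig_mag A < 1"
  obtains \<theta> where "0 < \<theta>" "\<theta> < 1" "\<And>x. 1 \<bullet> x = 0 \<Longrightarrow> norm (A *v x) \<le> \<theta> * norm x"
proof (cases "{x :: real^'k. 1 \<bullet> x = 0} = {0}")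
  case True
  then have "x = 0" if "1 \<bullet> x = 0" for x :: "real^'k"
    using that by blast
  then have "norm (A *v x) \<le> 1/2 * norm x" if "1 \<bullet> x = 0" for x
    using that by fastforce
  then show ?thesis
    by (intro that[of "1/2"]) simp_all
next
  case False
  have "1 \<bullet> (A *v x) = 0" if "1 \<bullet> x = 0" for x
    using inner_symmetric_matrix[OF sym, of 1 x] that stoch by simp
  then obtain y b where y: "1 \<bullet> y = 0" "y \<noteq> 0" "A *v y = b *\<^sub>R y"
    and bound: "\<And>x. 1 \<bullet> x = 0 \<Longrightarrow> norm (A *v x) \<le> \<bar>b\<bar> * norm x"
    using symmetric_matrix_extremal_eigenvector[OF sym subspace_hyperplane False]
    unfolding mem_Collect_eq by blast
  have "\<bar>b\<bar> < 1"
  proof (rule ccontr)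
    assume large: "\<not> \<bar>b\<bar> < 1"
    have "(1 :: real^'k) \<noteq> 0"
      by (simp add: vec_eq_iff)
    then have "1 \<noteq> y" and "independent {1, y}"
      using y(1,2) pairwise_orthogonal_independent[of "{1, y}"]
      by (auto simp: pairwise_insert orthogonal_def inner_commute)
    then have "1 \<le> second_largest_eig_mag A"
      using y(3) stoch large
      by (intro second_largest_eig_mag_ge[of "{1, y}" A "\<lambda>x. if x = y then b else 1"]) auto
    with gap show False
      by simp
  qed
  show thesis
  proof
    show "0 < max \<bar>b\<bar> (1/2)" "max \<bar>b\<bar> (1/2) < 1"
      using \<open>\<bar>b\<bar> < 1\<close> by auto
    show "norm (A *v x) \<le> max \<bar>b\<bar> (1/2) * norm x" if "1 \<bullet> x = 0" for x
      using bound[OF that] by (rule order_trans) (intro mult_right_mono; simp)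
  qed
qed

section \<open>Averages and expectations over sample paths\<close>

definition average :: "('n::finite \<Rightarrow> 'a::real_vector) \<Rightarrow> 'a" where
  "average f = (1 / real CARD('n)) *\<^sub>R (\<Sum>n\<in>UNIV. f n)"

lemma real_card_ge_1: "1 \<le> real CARD('n::finite)"
  by (simp add: Suc_leI)

lemma average_add: "average (\<lambda>n. f n + g n) = average f + average g"
  and average_diff: "average (\<lambda>n. f n - g n) = average f - average g"
  by (simp_all add: average_def sum.distrib sum_subtractf
      scaleR_right_distrib scaleR_right_diff_distrib)

lemma average_const [simp]: "average (\<lambda>n::'n::finite. c) = c"
  by (simp add: average_def sum_constant_scaleR)

lemma average_cmult: "average (\<lambda>n. c * f n) = c * average f" for c :: real
  by (simp add: average_def sum_distrib_left)

lemma inner_average_right: "x \<bullet> average f = average (\<lambda>n. x \<bullet> f n)"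
  by (simp add: average_def inner_sum_right)

lemma average_mono: "(\<And>n. f n \<le> g n) \<Longrightarrow> average f \<le> average g" for f g :: "'n::finite \<Rightarrow> real"
  by (simp add: average_def sum_mono divide_right_mono)

lemma average_le: "(\<And>n. f n \<le> B) \<Longrightarrow> average f \<le> B" for f :: "'n::finite \<Rightarrow> real"
  using average_mono[of f "\<lambda>n. B"] by simp

lemma norm_average_le:
  fixes f :: "'n::finite \<Rightarrow> 'a::real_normed_vector"
  assumes "\<And>n. norm (f n) \<le> B"
  shows "norm (average f) \<le> B"
proof -
  have "norm (average f) \<le> average (\<lambda>n. norm (f n))"
    by (simp add: average_def norm_sum divide_right_mono)
  also have "\<dots> \<le> B"
    using assms by (rule average_le)
  finally show ?thesis .
qed

lemma average_norm_square_step: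
  fixes g :: "'n::finite \<Rightarrow> 'a::real_inner"
  shows "average (\<lambda>n. (norm (x - \<mu> *\<^sub>R g n))\<^sup>2) =
    (norm x)\<^sup>2 - 2 * \<mu> * (x \<bullet> average g) + \<mu>\<^sup>2 * average (\<lambda>n. (norm (g n))\<^sup>2)"
proof -
  have "(norm (x - \<mu> *\<^sub>R g n))\<^sup>2 = (norm x)\<^sup>2 - 2 * \<mu> * (x \<bullet> g n) + \<mu>\<^sup>2 * (norm (g n))\<^sup>2" for n
    unfolding power2_norm_eq_inner
    by (simp add: inner_diff inner_commute power2_eq_square algebra_simps)
  then show ?thesis
    by (simp add: average_add average_diff average_cmult inner_average_right)
qed

lemma average_sum_fun_upd:
  fixes f g :: "'n::finite \<Rightarrow> real"
  shows "average (\<lambda>n'. \<Sum>n\<in>UNIV. if n = n' then g n else f n) =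
    (1 - 1 / real CARD('n)) * (\<Sum>n\<in>UNIV. f n) + average g"
proof -
  have "(\<Sum>n\<in>UNIV. if n = n' then g n else f n) = (\<Sum>n\<in>UNIV. f n) - f n' + g n'" for n'
    by (subst (1 2) sum.remove[of UNIV n']) (auto intro!: sum.cong)
  then show ?thesis
    by (simp add: average_add average_diff) (simp add: average_def left_diff_distrib)
qed

lemma expect_paths_add: "expect_paths i (\<lambda>ns. f ns + g ns) = expect_paths i f + expect_paths i g"
  by (simp add: expect_paths_def sum.distrib add_divide_distrib)

lemma expect_paths_cmult: "expect_paths i (\<lambda>ns. c * f ns) = c * expect_paths i f"
  by (simp add: expect_paths_def sum_distrib_left)

lemma expect_paths_sum:
  "expect_paths i (\<lambda>ns. \<Sum>x\<in>X. f x ns) = (\<Sum>x\<in>X. expect_paths i (f x))"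
  unfolding expect_paths_def by (subst sum.swap) (simp add: sum_divide_distrib)

lemma expect_paths_mono: "(\<And>ns. f ns \<le> g ns) \<Longrightarrow> expect_paths i f \<le> expect_paths i g"
  by (simp add: expect_paths_def sum_mono divide_right_mono)

lemma expect_paths_Suc:
  fixes f :: "(nat \<Rightarrow> 'n::finite) \<Rightarrow> real"
  shows "expect_paths (Suc i) f = expect_paths i (\<lambda>ns. average (\<lambda>n. f (ns(Suc i := n))))"
proof -
  let ?P = "PiE {1..i} (\<lambda>_. UNIV :: 'n set)"
  have "PiE {1..Suc i} (\<lambda>_. UNIV :: 'n set) = (\<lambda>(y, g). g(Suc i := y)) ` (UNIV \<times> ?P)"
    by (simp add: PiE_insert_eq atLeastAtMostSuc_conv)
  then have "(\<Sum>ns\<in>PiE {1..Suc i} (\<lambda>_. UNIV). f ns) = (\<Sum>(n, ns)\<in>UNIV \<times> ?P. f (ns(Suc i := n)))"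
    by (subst sum.reindex_cong[OF inj_combinator]) (auto simp: case_prod_unfold)
  also have "\<dots> = (\<Sum>ns\<in>?P. \<Sum>n\<in>UNIV. f (ns(Suc i := n)))"
    by (subst sum.cartesian_product[symmetric], subst sum.swap) simp
  finally show ?thesis
    by (simp add: expect_paths_def average_def sum_divide_distrib)
qed

lemma expect_paths_eq_of_dependence:
  fixes f :: "(nat \<Rightarrow> 'n::finite) \<Rightarrow> real"
  assumes dep: "\<And>ns ns'. (\<And>s. 1 \<le> s \<Longrightarrow> s \<le> m \<Longrightarrow> ns s = ns' s) \<Longrightarrow> f ns = f ns'"
    and "m \<le> i"
  shows "expect_paths i f = expect_paths m f"
  using assms(2)
proof (induction i rule: dec_induct)
  case (step i)
  have "f (ns(Suc i := n)) = f ns" for ns n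
    using step by (intro dep) auto
  then have "expect_paths (Suc i) f = expect_paths i f"
    by (simp add: expect_paths_Suc)
  with step show ?case
    by simp
qed simp

section \<open>Mean and deviation of vectors\<close>

definition vec_mean :: "real^'k \<Rightarrow> real" where
  "vec_mean x = average (($) x)"

definition deviation :: "real^'k \<Rightarrow> real^'k" where
  "deviation x = x - vec (vec_mean x)"

lemma vec_mean_add: "vec_mean (x + y) = vec_mean x + vec_mean y"
  and vec_mean_diff: "vec_mean (x - y) = vec_mean x - vec_mean y"
  by (simp_all add: vec_mean_def average_def sum.distrib sum_subtractf
      add_divide_distrib diff_divide_distrib)

lemma vec_mean_eq_inner_one: "vec_mean x = (1 \<bullet> x) / real CARD('k)" for x :: "real^'k"
  by (simp add: vec_mean_def average_def inner_vec_def)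

lemma abs_vec_mean_le_norm: "\<bar>vec_mean x\<bar> \<le> norm x"
  unfolding vec_mean_def real_norm_def[symmetric]
  by (rule norm_average_le) (simp add: component_le_norm_cart)

lemma deviation_add: "deviation (x + y) = deviation x + deviation y"
  by (simp add: deviation_def vec_mean_add vec_add)

lemma inner_one_deviation: "1 \<bullet> deviation x = 0"
  by (simp add: deviation_def inner_vec_def sum_subtractf vec_mean_def average_def)

lemma norm_deviation_le: "norm (deviation x) \<le> norm x"
proof -
  have "orthogonal (deviation x) (vec (vec_mean x))"
    using inner_one_deviation[of x]
    by (simp add: orthogonal_def inner_vec_def flip: sum_distrib_right)
  then have "(norm x)\<^sup>2 = (norm (deviation x))\<^sup>2 + (norm (vec (vec_mean x) :: real^'a))\<^sup>2"
    by (metis norm_add_Pythagorean deviation_def diff_add_cancel)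
  then have "(norm (deviation x))\<^sup>2 \<le> (norm x)\<^sup>2"
    by simp
  then show ?thesis
    by (rule power2_le_imp_le) simp
qed

lemma abs_component_diff_le: "\<bar>x$k - m\<bar> \<le> norm (deviation x) + \<bar>vec_mean x - m\<bar>"
  using component_le_norm_cart[of "deviation x" k] by (simp add: deviation_def)

section \<open>Norm inequalities\<close>

lemma norm_add_power2_le:
  fixes x y :: "'a::real_normed_vector"
  assumes "0 < t"
  shows "(norm (x + y))\<^sup>2 \<le> (1 + t) * (norm x)\<^sup>2 + (1 + 1 / t) * (norm y)\<^sup>2"
proof -
  have "(norm (x + y))\<^sup>2 \<le> (norm x + norm y)\<^sup>2"
    by (intro power_mono norm_triangle_ineq) simp
  also have "\<dots> = (1 + t) * (norm x)\<^sup>2 + (1 + 1 / t) * (norm y)\<^sup>2 - (t * norm x - norm y)\<^sup>2 / t"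
    using assms by (simp add: field_simps power2_eq_square)
  also have "\<dots> \<le> (1 + t) * (norm x)\<^sup>2 + (1 + 1 / t) * (norm y)\<^sup>2"
    using assms by simp
  finally show ?thesis .
qed

lemma neg_two_inner_le:
  fixes x y :: "'a::real_inner"
  assumes "0 < c"
  shows "- 2 * (x \<bullet> y) \<le> c * (norm x)\<^sup>2 + (norm y)\<^sup>2 / c"
proof -
  have "0 \<le> (norm (c *\<^sub>R x + y))\<^sup>2 / c"
    using assms by simp
  also have "(norm (c *\<^sub>R x + y))\<^sup>2 = c\<^sup>2 * (norm x)\<^sup>2 + 2 * c * (x \<bullet> y) + (norm y)\<^sup>2"
    unfolding power2_norm_eq_inner
    by (simp add: inner_add inner_commute power2_eq_square algebra_simps)
  also have "\<dots> / c = c * (norm x)\<^sup>2 + 2 * (x \<bullet> y) + (norm y)\<^sup>2 / c"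
    using assms by (simp add: field_simps power2_eq_square)
  finally show ?thesis
    by simp
qed

lemma norm_telescope_power2_le:
  fixes w :: "nat \<Rightarrow> 'a::real_normed_vector"
  assumes "s \<le> i" and step: "\<And>j. \<lbrakk>s \<le> j; j < i\<rbrakk> \<Longrightarrow> (norm (w (Suc j) - w j))\<^sup>2 \<le> B"
  shows "(norm (w i - w s))\<^sup>2 \<le> (real (i - s))\<^sup>2 * B"
proof (cases "s = i")
  case False
  then have "0 \<le> B"
    using step[of s] assms(1) by (meson le_neq_implies_less order_refl order_trans zero_le_power2)
  have "norm (w i - w s) = norm (\<Sum>j\<in>{s..<i}. w (Suc j) - w j)"
    using assms(1) by (simp add: sum_Suc_diff')
  also have "\<dots> \<le> (\<Sum>j\<in>{s..<i}. sqrt B)"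
    by (rule sum_norm_le) (auto intro: real_le_rsqrt step)
  finally have "(norm (w i - w s))\<^sup>2 \<le> (real (i - s) * sqrt B)\<^sup>2"
    by (intro power_mono) auto
  then show ?thesis
    using \<open>0 \<le> B\<close> by (simp add: power_mult_distrib)
qed simp

section \<open>Gradients\<close>

lemma gradient_eq_0_at_minimum:
  fixes f :: "'a::real_inner \<Rightarrow> real"
  assumes "(f has_derivative (\<lambda>d. g \<bullet> d)) (at x)" and "\<And>y. f x \<le> f y"
  shows "g = 0"
proof -
  have "(\<lambda>d. g \<bullet> d) = (\<lambda>d. 0)"
    using assms by (intro differential_zero_maxmin[of x UNIV f]) auto
  then show ?thesis
    by (metis inner_eq_zero_iff)
qed

lemma gradient_eq_of_translates_eq:
  fixes f :: "'a::real_inner \<Rightarrow> real"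
  assumes f: "\<And>x. (f has_derivative (\<lambda>d. g x \<bullet> d)) (at x)"
    and eq: "\<And>t. f (x + t) = f (y + t)"
  shows "g x = g y"
proof -
  have translate: "((\<lambda>t. f (z + t)) has_derivative (\<lambda>d. g z \<bullet> d)) (at 0)" for z
    by (rule has_derivative_compose[of "\<lambda>t. z + t" "\<lambda>d. d"]) (auto intro!: derivative_eq_intros f)
  have "(\<lambda>d. g x \<bullet> d) = (\<lambda>d. g y \<bullet> d)"
    using translate[of x] translate[of y] unfolding eq by (rule has_derivative_unique)
  then show ?thesis
    by (metis vector_eq_rdot)
qed

lemma gradient_orthogonal_of_line_const:
  fixes f :: "'a::real_inner \<Rightarrow> real"
  assumes f: "(f has_derivative (\<lambda>d. g \<bullet> d)) (at x)" and const: "\<And>t. f (x + t *\<^sub>R v) = f x"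
  shows "g \<bullet> v = 0"
proof -
  have "((\<lambda>t. f (x + t *\<^sub>R v)) has_derivative (\<lambda>t. g \<bullet> (t *\<^sub>R v))) (at 0)"
    by (rule has_derivative_compose[of "\<lambda>t. x + t *\<^sub>R v" "\<lambda>t. t *\<^sub>R v"])
      (auto intro!: derivative_eq_intros simp: f)
  then have "(\<lambda>t. g \<bullet> (t *\<^sub>R v)) = (\<lambda>t::real. 0)"
    unfolding const by (rule has_derivative_unique) simp
  then show ?thesis
    by (metis scaleR_one)
qed

lemma gradient_cong_on_coordinates:
  fixes f :: "real^'m \<Rightarrow> real"
  assumes "\<And>x. (f has_derivative (\<lambda>d. g x \<bullet> d)) (at x)"
    and local: "\<And>x y. (\<forall>j. P j \<longrightarrow> x$j = y$j) \<Longrightarrow> f x = f y" and eq: "\<And>j. P j \<Longrightarrow> x$j = y$j"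
  shows "g x = g y"
  using assms(1) by (rule gradient_eq_of_translates_eq) (auto intro!: local simp: eq)

lemma gradient_nth_eq_0:
  fixes f :: "real^'m \<Rightarrow> real"
  assumes "(f has_derivative (\<lambda>d. g \<bullet> d)) (at x)"
    and local: "\<And>x y. (\<forall>j. P j \<longrightarrow> x$j = y$j) \<Longrightarrow> f x = f y" and "\<not> P j"
  shows "g $ j = 0"
proof -
  have "f (x + t *\<^sub>R axis j 1) = f x" for t
    by (rule local) (use \<open>\<not> P j\<close> in \<open>auto simp: axis_def\<close>)
  then have "g \<bullet> axis j 1 = 0"
    by (rule gradient_orthogonal_of_line_const[OF assms(1)])
  then show ?thesis
    by (simp add: inner_axis)
qed

definition risk ::
    "('n::finite \<Rightarrow> real^'m) \<Rightarrow> ('n \<Rightarrow> real) \<Rightarrow> (real \<Rightarrow> real \<Rightarrow> real) \<Rightarrow> ('k::finite \<Rightarrow> real^'m \<Rightarrow> real)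
      \<Rightarrow> real^'m \<Rightarrow> real" where
  "risk h \<gamma> Q r w = average (\<lambda>n. Q (h n \<bullet> w) (\<gamma> n)) + (\<Sum>k\<in>UNIV. r k w)"

definition risk_gradient ::
    "('n::finite \<Rightarrow> real^'m) \<Rightarrow> ('n \<Rightarrow> real) \<Rightarrow> (real \<Rightarrow> real \<Rightarrow> real) \<Rightarrow> ('k::finite \<Rightarrow> real^'m \<Rightarrow> real^'m)
      \<Rightarrow> real^'m \<Rightarrow> real^'m" where
  "risk_gradient h \<gamma> dQ gr w = average (\<lambda>n. dQ (h n \<bullet> w) (\<gamma> n) *\<^sub>R h n) + (\<Sum>k\<in>UNIV. gr k w)"

lemma risk_has_derivative:
  assumes Q: "\<And>z g. ((\<lambda>z. Q z g) has_real_derivative dQ z g) (at z)"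
    and r: "\<And>k x. (r k has_derivative (\<lambda>d. gr k x \<bullet> d)) (at x)"
  shows "(risk h \<gamma> Q r has_derivative (\<lambda>d. risk_gradient h \<gamma> dQ gr w \<bullet> d)) (at w)"
proof -
  have "((\<lambda>w. Q (h n \<bullet> w) (\<gamma> n)) has_derivative (\<lambda>d. dQ (h n \<bullet> w) (\<gamma> n) * (h n \<bullet> d))) (at w)" for n
    using Q[where z = "h n \<bullet> w" and g = "\<gamma> n"] unfolding has_field_derivative_def
    by (intro has_derivative_compose[of "\<lambda>w. h n \<bullet> w" "\<lambda>d. h n \<bullet> d" w UNIV "\<lambda>z. Q z (\<gamma> n)"]
        has_derivative_inner_right has_derivative_ident)
  then show ?thesis
    unfolding risk_def risk_gradient_def average_def
    by (auto intro!: derivative_eq_intros r simp: inner_add_left inner_sum_left)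
qed

section \<open>Linear convergence of the delayed recursion\<close>

lemma power_le_delayed_power:
  fixes \<rho> :: real
  assumes \<rho>: "0 < \<rho>" "\<rho> \<le> 1" and q: "1 \<le> q * \<rho> ^ T" and "m \<le> j + T"
  shows "\<rho> ^ j \<le> q * \<rho> ^ m"
proof -
  have "0 < q * \<rho> ^ T"
    using q by linarith
  then have "0 < q"
    using \<rho>(1) by (simp add: zero_less_mult_iff)
  have "\<rho> ^ j \<le> (q * \<rho> ^ T) * \<rho> ^ j"
    using mult_right_mono[OF q, of "\<rho> ^ j"] \<rho> by simp
  also have "\<dots> = q * \<rho> ^ (j + T)"
    by (simp add: power_add)
  also have "\<dots> \<le> q * \<rho> ^ m"
    using assms(4) \<rho> \<open>0 < q\<close> by (intro mult_left_mono power_decreasing) auto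
  finally show ?thesis .
qed

lemma geometric_decay_of_windowed_step:
  fixes v :: "nat \<Rightarrow> real"
  assumes \<rho>: "0 < \<rho>" "\<rho> \<le> 1" and q: "1 \<le> q * \<rho> ^ T"
    and step: "\<And>i X. \<lbrakk>T \<le> i; 0 \<le> X; v i \<le> X; \<And>j. \<lbrakk>i - T \<le> j; j \<le> i\<rbrakk> \<Longrightarrow> v j \<le> q * X\<rbrakk>
      \<Longrightarrow> v (Suc i) \<le> \<rho> * X"
  obtains C where "0 \<le> C" "\<And>i. v i \<le> C * \<rho> ^ i"
proof -
  define C where "C = (\<Sum>i\<le>T. \<bar>v i\<bar> / \<rho> ^ i)"
  have C: "0 \<le> C"
    using \<rho> by (simp add: C_def sum_nonneg)
  have "v i \<le> C * \<rho> ^ i" for i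
  proof (induction i rule: less_induct)
    case (less i)
    show ?case
    proof (cases "i \<le> T")
      case True
      then have "\<bar>v i\<bar> / \<rho> ^ i \<le> C"
        unfolding C_def using \<rho> by (intro member_le_sum[of i "{..T}" "\<lambda>i. \<bar>v i\<bar> / \<rho> ^ i"]) auto
      then show ?thesis
        using \<rho> by (simp add: pos_divide_le_eq)
    next
      case False
      then obtain m where m: "i = Suc m" "T \<le> m"
        by (cases i) auto
      have "v j \<le> q * (C * \<rho> ^ m)" if "m - T \<le> j" "j \<le> m" for j
      proof -
        have "C * \<rho> ^ j \<le> C * (q * \<rho> ^ m)"
          using that by (intro mult_left_mono power_le_delayed_power[OF \<rho> q] C) simp
        then show ?thesis
          using less[of j] that m by (simp add: mult.left_commute)
      qed
      then have "v (Suc m) \<le> \<rho> * (C * \<rho> ^ m)"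
        using C \<rho> m less[of m] by (intro step) auto
      then show ?thesis
        by (simp add: m mult_ac)
    qed
  qed
  with C show thesis
    by (rule that)
qed

definition delayed_recursion ::
    "nat \<Rightarrow> real \<Rightarrow> real \<Rightarrow> real \<Rightarrow> real \<Rightarrow> real
      \<Rightarrow> (nat \<Rightarrow> real) \<Rightarrow> (nat \<Rightarrow> real) \<Rightarrow> (nat \<Rightarrow> real) \<Rightarrow> bool" where
  "delayed_recursion J N c \<theta> \<nu> \<mu> a b d \<longleftrightarrow> (\<forall>i\<ge>2 * J.
     let s = i - J + 1; W = (\<Sum>j\<in>{i - 2 * J..i}. a j + b j + d j)
     in a (Suc i) \<le> (1 - \<mu> * \<nu>) * a i + \<mu> * c * (b s + d s) + \<mu>\<^sup>2 * c * W \<and>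
        b (Suc i) \<le> (1 - 1 / N) * b i + \<theta> / N * b s + c * d s \<and>
        d (Suc i) \<le> (1 - 1 / (2 * N)) * d i + \<mu>\<^sup>2 * c * W)"

text \<open>For these weights the recursion propagates \<open>a \<le> X\<close>, \<open>b \<le> \<beta> X\<close>, \<open>d \<le> \<kappa> X\<close>
  with factor \<open>\<rho> = 1 - \<mu> \<nu> / 5\<close>; \<open>q\<close> pays for a delay of up to \<open>2 J\<close>.\<close>

definition decay_weights ::
    "nat \<Rightarrow> real \<Rightarrow> real \<Rightarrow> real \<Rightarrow> real \<Rightarrow> real \<Rightarrow> real \<Rightarrow> real \<Rightarrow> real \<Rightarrow> bool" where
  "decay_weights J N c \<theta> \<nu> \<mu> \<beta> \<kappa> q \<longleftrightarrow>
     (let \<rho> = 1 - \<mu> * \<nu> / 5; l = 3 * real (2 * J + 1) in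
      0 < \<mu> \<and> \<mu> * \<nu> < 1 \<and> 0 < \<beta> \<and> \<beta> \<le> 1 \<and> 0 < \<kappa> \<and> \<kappa> \<le> 1 \<and> 0 < q \<and> 1 < q * \<rho> ^ (2 * J) \<and>
      c * ((\<beta> + \<kappa>) * q) + \<mu> * (c * (l * q)) < 4 / 5 * \<nu> \<and>
      (1 - 1 / N) * \<beta> + \<theta> / N * (\<beta> * q) + c * (\<kappa> * q) < \<rho> * \<beta> \<and>
      (1 - 1 / (2 * N)) * \<kappa> + \<mu>\<^sup>2 * (c * (l * q)) < \<rho> * \<kappa>)"

lemma window_sum_le:
  fixes a b d :: "nat \<Rightarrow> real"
  assumes "T \<le> i" and "0 \<le> Y" "\<beta> \<le> 1" "\<kappa> \<le> 1"
    and past: "\<And>j. \<lbrakk>i - T \<le> j; j \<le> i\<rbrakk> \<Longrightarrow> a j \<le> Y \<and> b j \<le> \<beta> * Y \<and> d j \<le> \<kappa> * Y"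
  shows "(\<Sum>j\<in>{i - T..i}. a j + b j + d j) \<le> 3 * real (T + 1) * Y"
proof -
  have "\<beta> * Y \<le> 1 * Y" "\<kappa> * Y \<le> 1 * Y"
    using assms by (intro mult_right_mono; simp)+
  then have "a j + b j + d j \<le> 3 * Y" if "j \<in> {i - T..i}" for j
    using past[of j] that by simp
  then have "(\<Sum>j\<in>{i - T..i}. a j + b j + d j) \<le> of_nat (card {i - T..i}) * (3 * Y)"
    by (rule sum_bounded_above)
  then show ?thesis
    using \<open>T \<le> i\<close> by (simp add: algebra_simps)
qed

lemma delayed_recursion_step:
  assumes "1 \<le> J" "1 \<le> N" "0 \<le> c" "0 \<le> \<theta>"
    and w: "decay_weights J N c \<theta> \<nu> \<mu> \<beta> \<kappa> q"
    and rec: "delayed_recursion J N c \<theta> \<nu> \<mu> a b d"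
    and i: "2 * J \<le> i" and X: "0 \<le> X"
    and now: "a i \<le> X" "b i \<le> \<beta> * X" "d i \<le> \<kappa> * X"
    and past: "\<And>j. \<lbrakk>i - 2 * J \<le> j; j \<le> i\<rbrakk> \<Longrightarrow> a j \<le> q * X \<and> b j \<le> \<beta> * (q * X) \<and> d j \<le> \<kappa> * (q * X)"
  shows "a (Suc i) \<le> (1 - \<mu> * \<nu> / 5) * X" "b (Suc i) \<le> \<beta> * ((1 - \<mu> * \<nu> / 5) * X)"
    "d (Suc i) \<le> \<kappa> * ((1 - \<mu> * \<nu> / 5) * X)"
proof -
  define \<rho> l where "\<rho> = 1 - \<mu> * \<nu> / 5" and "l = 3 * real (2 * J + 1)"
  define s W where "s = i - J + 1" and "W = (\<Sum>j\<in>{i - 2 * J..i}. a j + b j + d j)"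
  have \<mu>: "0 < \<mu>" "\<mu> * \<nu> < 1" and \<beta>: "0 < \<beta>" "\<beta> \<le> 1" and \<kappa>: "0 < \<kappa>" "\<kappa> \<le> 1" and "0 < q"
    and coeff_a: "c * ((\<beta> + \<kappa>) * q) + \<mu> * (c * (l * q)) < 4 / 5 * \<nu>"
    and coeff_b: "(1 - 1 / N) * \<beta> + \<theta> / N * (\<beta> * q) + c * (\<kappa> * q) < \<rho> * \<beta>"
    and coeff_d: "(1 - 1 / (2 * N)) * \<kappa> + \<mu>\<^sup>2 * (c * (l * q)) < \<rho> * \<kappa>"
    using w by (auto simp: decay_weights_def Let_def \<rho>_def l_def)
  have rec_a: "a (Suc i) \<le> (1 - \<mu> * \<nu>) * a i + \<mu> * c * (b s + d s) + \<mu>\<^sup>2 * c * W"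
    and rec_b: "b (Suc i) \<le> (1 - 1 / N) * b i + \<theta> / N * b s + c * d s"
    and rec_d: "d (Suc i) \<le> (1 - 1 / (2 * N)) * d i + \<mu>\<^sup>2 * c * W"
    using rec i unfolding delayed_recursion_def Let_def s_def W_def by blast+
  have s: "b s \<le> \<beta> * (q * X)" "d s \<le> \<kappa> * (q * X)"
    using past[of s] i \<open>1 \<le> J\<close> by (auto simp: s_def)
  have W: "W \<le> l * (q * X)"
    unfolding W_def l_def using i X \<open>0 < q\<close> \<beta> \<kappa> past
    by (intro window_sum_le[where \<beta> = \<beta> and \<kappa> = \<kappa>]) auto
  have "a (Suc i) \<le> (1 - \<mu> * \<nu>) * X + \<mu> * c * (\<beta> * (q * X) + \<kappa> * (q * X)) + \<mu>\<^sup>2 * c * (l * (q * X))"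
    by (rule order_trans[OF rec_a], intro add_mono mult_left_mono now s W)
      (use \<mu> \<open>0 \<le> c\<close> in auto)
  also have "\<dots> = (1 - \<mu> * \<nu>) * X + \<mu> * (c * ((\<beta> + \<kappa>) * q) + \<mu> * (c * (l * q))) * X"
    by (simp add: power2_eq_square algebra_simps)
  also have "\<dots> \<le> (1 - \<mu> * \<nu>) * X + \<mu> * (4 / 5 * \<nu>) * X"
    using \<mu> X coeff_a by (intro add_left_mono mult_right_mono mult_left_mono) auto
  finally show "a (Suc i) \<le> (1 - \<mu> * \<nu> / 5) * X"
    by (simp add: algebra_simps)
  have "b (Suc i) \<le> (1 - 1 / N) * (\<beta> * X) + \<theta> / N * (\<beta> * (q * X)) + c * (\<kappa> * (q * X))"
    by (rule order_trans[OF rec_b], intro add_mono mult_left_mono now s)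
      (use \<open>1 \<le> N\<close> \<open>0 \<le> c\<close> \<open>0 \<le> \<theta>\<close> in auto)
  also have "\<dots> = ((1 - 1 / N) * \<beta> + \<theta> / N * (\<beta> * q) + c * (\<kappa> * q)) * X"
    by (simp add: algebra_simps)
  also have "\<dots> \<le> \<rho> * \<beta> * X"
    using coeff_b X by (intro mult_right_mono) auto
  finally show "b (Suc i) \<le> \<beta> * ((1 - \<mu> * \<nu> / 5) * X)"
    by (simp add: \<rho>_def mult_ac)
  have "d (Suc i) \<le> (1 - 1 / (2 * N)) * (\<kappa> * X) + \<mu>\<^sup>2 * c * (l * (q * X))"
    by (rule order_trans[OF rec_d], intro add_mono mult_left_mono now W)
      (use \<open>1 \<le> N\<close> \<open>0 \<le> c\<close> in auto)
  also have "\<dots> = ((1 - 1 / (2 * N)) * \<kappa> + \<mu>\<^sup>2 * (c * (l * q))) * X"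
    by (simp add: algebra_simps)
  also have "\<dots> \<le> \<rho> * \<kappa> * X"
    using coeff_d X by (intro mult_right_mono) auto
  finally show "d (Suc i) \<le> \<kappa> * ((1 - \<mu> * \<nu> / 5) * X)"
    by (simp add: \<rho>_def mult_ac)
qed

lemma delayed_recursion_decay:
  assumes "1 \<le> J" "1 \<le> N" "0 \<le> c" "0 \<le> \<theta>" "0 < \<nu>"
    and w: "decay_weights J N c \<theta> \<nu> \<mu> \<beta> \<kappa> q"
    and rec: "delayed_recursion J N c \<theta> \<nu> \<mu> a b d"
  obtains C where "0 \<le> C" "\<And>i. a i \<le> C * (1 - \<mu> * \<nu> / 5) ^ i"
proof -
  define \<rho> where "\<rho> = 1 - \<mu> * \<nu> / 5"
  have "0 < \<mu>" "\<mu> * \<nu> < 1" and \<beta>: "0 < \<beta>" and \<kappa>: "0 < \<kappa>" and q: "1 < q * \<rho> ^ (2 * J)"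
    using w by (auto simp: decay_weights_def Let_def \<rho>_def)
  then have \<rho>: "0 < \<rho>" "\<rho> \<le> 1"
    using \<open>0 < \<nu>\<close> by (auto simp: \<rho>_def)
  define v where "v i = max (a i) (max (b i / \<beta>) (d i / \<kappa>))" for i
  have v_le_iff: "v i \<le> X \<longleftrightarrow> a i \<le> X \<and> b i \<le> \<beta> * X \<and> d i \<le> \<kappa> * X" for i X
    using \<beta> \<kappa> by (simp add: v_def pos_divide_le_eq mult.commute)
  have "v (Suc i) \<le> \<rho> * X"
    if "2 * J \<le> i" "0 \<le> X" "v i \<le> X" "\<And>j. \<lbrakk>i - 2 * J \<le> j; j \<le> i\<rbrakk> \<Longrightarrow> v j \<le> q * X" for i X
    using that delayed_recursion_step[OF assms(1-4) w rec that(1,2)]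
    unfolding v_le_iff \<rho>_def by blast
  then obtain C where "0 \<le> C" "\<And>i. v i \<le> C * \<rho> ^ i"
    using geometric_decay_of_windowed_step[of \<rho> q "2 * J" v] \<rho> q by auto
  then show thesis
    using that unfolding v_le_iff \<rho>_def by blast
qed

lemma eventually_at_right_less_of_isCont:
  fixes f g :: "real \<Rightarrow> real"
  assumes "isCont f x" "isCont g x" "f x < g x"
  shows "\<forall>\<^sub>F y in at_right x. f y < g y"
proof -
  have "((\<lambda>y. g y - f y) \<longlongrightarrow> g x - f x) (at_right x)"
    using assms(1,2)
    by (intro tendsto_diff; simp add: continuous_within filterlim_at_split isCont_def)
  then have "\<forall>\<^sub>F y in at_right x. 0 < g y - f y"
    by (rule order_tendstoD) (use assms(3) in simp)
  then show ?thesis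
    by simp
qed

text \<open>\<open>\<beta>\<close> is fixed by the gain from \<open>b\<close> to \<open>a\<close>, then \<open>\<kappa>\<close> by the gain from \<open>d\<close> to \<open>b\<close>.
  The gain from \<open>a\<close> back to \<open>d\<close> carries a factor \<open>\<mu>\<^sup>2\<close>, so every inequality
  is strict at \<open>\<mu> = 0\<close>.\<close>

lemma eventually_decay_weights:
  assumes N: "1 \<le> N" and c: "0 < c" and \<theta>: "0 < \<theta>" "\<theta> < 1" and \<nu>: "0 < \<nu>"
  obtains \<beta> \<kappa> q where "\<forall>\<^sub>F \<mu> in at_right 0. decay_weights J N c \<theta> \<nu> \<mu> \<beta> \<kappa> q"
proof -
  define q where "q = (1 + 1 / \<theta>) / 2"
  define \<beta> where "\<beta> = min 1 (\<nu> / (5 * c * q))"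
  define \<kappa> where "\<kappa> = min \<beta> (\<beta> * (1 - \<theta>) / (4 * N * c * q))"
  have q: "1 < q" "\<theta> * q = (1 + \<theta>) / 2"
    using \<theta> by (auto simp: q_def field_simps)
  then have pos: "0 < N" "0 < c * q" "0 < 5 * c * q" "0 < 4 * N * c * q"
    using N c by auto
  have \<beta>: "0 < \<beta>" "\<beta> \<le> 1" "\<beta> \<le> \<nu> / (5 * c * q)"
    using \<nu> pos(3) unfolding \<beta>_def by (auto intro: divide_pos_pos)
  have \<kappa>: "0 < \<kappa>" "\<kappa> \<le> \<beta>" "\<kappa> \<le> \<beta> * (1 - \<theta>) / (4 * N * c * q)"
    using \<beta>(1) \<theta> pos(4) unfolding \<kappa>_def by (auto intro!: divide_pos_pos)
  have "c * q * \<beta> \<le> \<nu> / 5"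
    using \<beta>(3) pos(3) by (simp add: pos_le_divide_eq field_simps)
  moreover have "c * q * \<kappa> \<le> c * q * \<beta>"
    using \<kappa>(2) pos(2) by (intro mult_left_mono) auto
  ultimately have coeff_a: "c * ((\<beta> + \<kappa>) * q) < 4 / 5 * \<nu>"
    using \<nu> by (simp add: algebra_simps)
  have "c * (\<kappa> * q) \<le> (1 - \<theta>) / (4 * N) * \<beta>"
    using \<kappa>(3) pos by (simp add: field_simps)
  moreover have "\<theta> / N * (\<beta> * q) = (1 + \<theta>) / (2 * N) * \<beta>"
    using arg_cong[OF q(2), of "\<lambda>t. t / N * \<beta>"] by (simp add: mult_ac)
  ultimately have "(1 - 1 / N) * \<beta> + \<theta> / N * (\<beta> * q) + c * (\<kappa> * q) \<le>
      (1 - 1 / N) * \<beta> + (1 + \<theta>) / (2 * N) * \<beta> + (1 - \<theta>) / (4 * N) * \<beta>"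
    by simp
  also have "\<dots> = \<beta> - (1 - \<theta>) / (4 * N) * \<beta>"
    using pos(1) by (simp add: field_simps)
  also have "\<dots> < \<beta>"
    using \<theta> pos(1) \<beta>(1) by simp
  finally have coeff_b: "(1 - 1 / N) * \<beta> + \<theta> / N * (\<beta> * q) + c * (\<kappa> * q) < \<beta>" .
  have coeff_d: "(1 - 1 / (2 * N)) * \<kappa> < \<kappa>"
    using \<kappa>(1) pos(1) by (simp add: field_simps)
  have "\<forall>\<^sub>F \<mu> in at_right 0. decay_weights J N c \<theta> \<nu> \<mu> \<beta> \<kappa> q"
    unfolding decay_weights_def Let_def using \<beta> \<kappa> \<nu> q coeff_a coeff_b coeff_d
    by (intro eventually_conj eventually_at_right_less eventually_at_right_less_of_isCont
        always_eventually allI continuous_intros) auto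
  then show thesis
    by (rule that)
qed

section \<open>The algorithm\<close>

locale pvrd =
  fixes A :: "real^'k::finite^'k" and blk :: "'m::finite \<Rightarrow> 'k"
    and h :: "'n::finite \<Rightarrow> real^'m" and \<gamma> :: "'n \<Rightarrow> real"
    and dQ :: "real \<Rightarrow> real \<Rightarrow> real" and gr :: "'k \<Rightarrow> real^'m \<Rightarrow> real^'m"
    and J :: nat and \<delta> \<eta> \<nu> \<theta> :: real and wstar :: "real^'m"
  assumes \<delta>_pos: "0 < \<delta>" and \<eta>_nonneg: "0 \<le> \<eta>" and \<nu>_pos: "0 < \<nu>" and J_pos: "1 \<le> J"
    and \<theta>: "0 < \<theta>" "\<theta> < 1"
    and dQ_lip: "\<bar>dQ z1 (\<gamma> n) - dQ z2 (\<gamma> n)\<bar> \<le> \<delta> * \<bar>z1 - z2\<bar>"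
    and gr_support: "blk j \<noteq> k \<Longrightarrow> gr k x $ j = 0"
    and gr_local: "(\<And>j. blk j = k \<Longrightarrow> x$j = y$j) \<Longrightarrow> gr k x = gr k y"
    and gr_lip: "norm ((\<Sum>k\<in>UNIV. gr k x) - (\<Sum>k\<in>UNIV. gr k y)) \<le> \<eta> * norm (x - y)"
    and risk_gradient_strongly_monotone: "\<nu> * (norm (w1 - w2))\<^sup>2 \<le>
      (risk_gradient h \<gamma> dQ gr w1 - risk_gradient h \<gamma> dQ gr w2) \<bullet> (w1 - w2)"
    and stationary: "risk_gradient h \<gamma> dQ gr wstar = 0"
    and A_sym: "transpose A = A" and A_stoch: "A *v 1 = 1"
    and A_contraction: "1 \<bullet> z = 0 \<Longrightarrow> norm (A *v z) \<le> \<theta> * norm z"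
begin

subsection \<open>The state in terms of global vectors\<close>

text \<open>Local vectors live in the full space, but the algorithm reads and writes only the
  coordinates of block \<open>k\<close> at agent \<open>k\<close>, so the blocks of all agents are glued into one vector.\<close>

definition weights :: "('m,'k,'n) pvrd_state \<Rightarrow> real^'m" where
  "weights S = (\<chi> j. fst S (blk j) $ j)"

definition u_table :: "('m,'k,'n) pvrd_state \<Rightarrow> 'n \<Rightarrow> real^'k" where
  "u_table S n = (\<chi> k. fst (snd S) k n)"

definition v_table :: "('m,'k,'n) pvrd_state \<Rightarrow> 'n \<Rightarrow> real^'k" where
  "v_table S n = (\<chi> k. snd (snd S) k n)"

definition predictions :: "'n \<Rightarrow> real^'m \<Rightarrow> real^'k" where
  "predictions n w = (\<chi> k. real CARD('k) * blkdot blk k (h n) w)"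

definition lag :: "('m,'k,'n) pvrd_state \<Rightarrow> 'n \<Rightarrow> real^'k" where
  "lag S n = predictions n (weights S) - v_table S n"

definition diffused :: "('m,'k,'n) pvrd_state \<Rightarrow> 'n \<Rightarrow> real^'k" where
  "diffused S n = (((*v) A) ^^ J) (u_table S n + lag S n)"

definition sample_gradient :: "'n \<Rightarrow> real^'k \<Rightarrow> real^'m" where
  "sample_gradient n z = (\<chi> j. dQ (z $ blk j) (\<gamma> n) * h n $ j)"

definition direction :: "'n \<Rightarrow> ('m,'k,'n) pvrd_state \<Rightarrow> ('m,'k,'n) pvrd_state \<Rightarrow> real^'m" where
  "direction n S S' = sample_gradient n (diffused S' n) - sample_gradient n (u_table S n)
     + average (\<lambda>m. sample_gradient m (u_table S m)) + (\<Sum>k\<in>UNIV. gr k (weights S))"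

abbreviation "step \<mu> n S S' \<equiv> pvrd_next A blk h \<gamma> dQ gr J \<mu> n S S'"

lemma blkdot_weights: "blkdot blk k x (fst S k) = blkdot blk k x (weights S)"
  by (simp add: blkdot_def weights_def)

lemma combine_funpow: "(\<chi> k. (combine A ^^ i) z k) = (((*v) A) ^^ i) (\<chi> k. z k)"
proof (induction i)
  case (Suc i)
  have "A$l$k = A$k$l" for k l
    using A_sym by (metis transpose_def vec_lambda_beta)
  then have "(\<chi> k. combine A y k) = A *v (\<chi> k. y k)" for y
    by (simp add: combine_def matrix_vector_mult_def)
  with Suc show ?case
    by simp
qed simp

lemma combine_funpow_pvrd_z0: "(combine A ^^ J) (pvrd_z0 blk h n S) k = diffused S n $ k"
proof -
  have "(combine A ^^ J) (pvrd_z0 blk h n S) k = (((*v) A) ^^ J) (\<chi> k. pvrd_z0 blk h n S k) $ k"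
    by (simp flip: combine_funpow)
  also have "(\<chi> k. pvrd_z0 blk h n S k) = u_table S n + lag S n"
    using blkdot_weights[of _ _ S]
    by (cases S) (simp add: vec_eq_iff pvrd_z0_def u_table_def predictions_def v_table_def lag_def)
  finally show ?thesis
    by (simp add: diffused_def)
qed

lemma gr_fst: "gr (blk j) (fst S (blk j)) $ j = (\<Sum>k\<in>UNIV. gr k (weights S)) $ j"
proof -
  have "(\<Sum>k\<in>UNIV. gr k (weights S)) $ j = (\<Sum>k\<in>{blk j}. gr k (weights S) $ j)"
    unfolding sum_component by (rule sum.mono_neutral_right) (auto intro: gr_support)
  moreover have "gr (blk j) (fst S (blk j)) = gr (blk j) (weights S)"
    by (rule gr_local) (simp add: weights_def)
  ultimately show ?thesis
    by simp
qed

lemma weights_step: "weights (step \<mu> n S S') = weights S - \<mu> *\<^sub>R direction n S S'"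
proof -
  obtain W U V where S: "S = (W, U, V)"
    by (cases S)
  have "weights (step \<mu> n S S') $ j = (weights S - \<mu> *\<^sub>R direction n S S') $ j" for j
    using gr_fst[of j S]
    by (simp add: S pvrd_next_def Let_def combine_funpow_pvrd_z0 weights_def direction_def
        sample_gradient_def u_table_def average_def blkvec_def left_diff_distrib)
  then show ?thesis
    by (simp add: vec_eq_iff)
qed

lemma u_table_step: "u_table (step \<mu> n' S S') n = (if n = n' then diffused S' n else u_table S n)"
  by (cases S) (simp add: u_table_def pvrd_next_def Let_def combine_funpow_pvrd_z0 vec_eq_iff)

lemma v_table_step:
  "v_table (step \<mu> n' S S') n = (if n = n' then predictions n (weights S') else v_table S n)"
  using blkdot_weights[of _ _ S']
  by (cases S; cases S')
    (simp add: v_table_def predictions_def pvrd_next_def Let_def pvrd_p_def vec_eq_iff)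

lemma linear_predictions: "linear (predictions n)"
  by (rule linearI)
    (simp_all add: predictions_def blkdot_def vec_eq_iff algebra_simps sum.distrib sum_distrib_left)

lemma vec_mean_predictions: "vec_mean (predictions n w) = h n \<bullet> w"
proof -
  have "(\<Sum>k\<in>UNIV. blkdot blk k (h n) w) = (\<Sum>j\<in>UNIV. h n $ j * w $ j)"
    unfolding blkdot_def using sum.group[of UNIV UNIV blk "\<lambda>j. h n $ j * w $ j"] by simp
  then show ?thesis
    by (simp add: vec_mean_def average_def predictions_def inner_vec_def flip: sum_distrib_left)
qed

subsection \<open>Averaging over the network\<close>

lemma vec_mean_mult: "vec_mean (A *v x) = vec_mean x"
  using inner_symmetric_matrix[OF A_sym, of 1 x] by (simp add: vec_mean_eq_inner_one A_stoch)

lemma deviation_mult: "deviation (A *v x) = A *v deviation x"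
proof -
  have "A *v vec c = vec c" for c
  proof -
    have "vec c = c *\<^sub>R (1 :: real^'k)"
      by (simp add: vec_eq_iff)
    then show ?thesis
      by (simp add: matrix_vector_mult_scaleR A_stoch)
  qed
  then show ?thesis
    by (simp add: deviation_def vec_mean_mult matrix_vector_mult_diff_distrib)
qed

lemma vec_mean_funpow: "vec_mean ((((*v) A) ^^ i) x) = vec_mean x"
  by (induction i) (simp_all add: vec_mean_mult)

lemma norm_deviation_funpow_le: "norm (deviation ((((*v) A) ^^ i) x)) \<le> \<theta> ^ i * norm (deviation x)"
proof (induction i)
  case (Suc i)
  have "norm (deviation ((((*v) A) ^^ Suc i) x)) \<le> \<theta> * norm (deviation ((((*v) A) ^^ i) x))"
    by (simp add: deviation_mult A_contraction inner_one_deviation)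
  also have "\<dots> \<le> \<theta> * (\<theta> ^ i * norm (deviation x))"
    using Suc \<theta> by (intro mult_left_mono) auto
  finally show ?case
    by simp
qed simp

lemma norm_deviation_diffused_le:
  "norm (deviation (diffused S n)) \<le> \<theta> * (norm (deviation (u_table S n)) + norm (lag S n))"
proof -
  have "norm (deviation (diffused S n)) \<le> \<theta> ^ J * norm (deviation (u_table S n + lag S n))"
    unfolding diffused_def by (rule norm_deviation_funpow_le)
  also have "\<dots> \<le> \<theta> * norm (deviation (u_table S n + lag S n))"
    using \<theta> J_pos power_decreasing[of 1 J \<theta>] by (intro mult_right_mono) auto
  also have "norm (deviation (u_table S n + lag S n)) \<le>
      norm (deviation (u_table S n)) + norm (lag S n)"
    unfolding deviation_add
    by (rule order_trans[OF norm_triangle_ineq]) (simp add: norm_deviation_le)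
  finally show ?thesis
    using \<theta> by simp
qed

text \<open>Averaging over the network preserves sums, so for a balanced state the mean of every
  value leaving the pipeline is the exact prediction.\<close>

definition balanced :: "('m,'k,'n) pvrd_state \<Rightarrow> bool" where
  "balanced S \<longleftrightarrow> (\<forall>n. vec_mean (u_table S n) = vec_mean (v_table S n))"

lemma vec_mean_diffused: "balanced S \<Longrightarrow> vec_mean (diffused S n) = h n \<bullet> weights S"
  by (simp add: diffused_def lag_def vec_mean_funpow vec_mean_add vec_mean_diff vec_mean_predictions
      balanced_def)

lemma balanced_step: "balanced S \<Longrightarrow> balanced S' \<Longrightarrow> balanced (step \<mu> n S S')"
  using vec_mean_diffused[of S']
  by (simp add: balanced_def u_table_step v_table_step vec_mean_predictions)

subsection \<open>Errors of a state\<close>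

definition weight_err :: "('m,'k,'n) pvrd_state \<Rightarrow> real" where
  "weight_err S = (norm (weights S - wstar))\<^sup>2"

definition consensus_err :: "('m,'k,'n) pvrd_state \<Rightarrow> real" where
  "consensus_err S = (\<Sum>n\<in>UNIV. (norm (deviation (u_table S n)))\<^sup>2)"

definition lag_err :: "('m,'k,'n) pvrd_state \<Rightarrow> real" where
  "lag_err S = (\<Sum>n\<in>UNIV. (norm (lag S n))\<^sup>2)"

definition total_err :: "('m,'k,'n) pvrd_state \<Rightarrow> real" where
  "total_err S = weight_err S + consensus_err S + lag_err S"

lemma err_nonneg: "0 \<le> weight_err S" "0 \<le> consensus_err S" "0 \<le> lag_err S" "0 \<le> total_err S"
  by (simp_all add: weight_err_def consensus_err_def lag_err_def total_err_def sum_nonneg)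

lemma sqrt_err_le_sqrt_total_err:
  "sqrt (weight_err S) \<le> sqrt (total_err S)" "sqrt (consensus_err S) \<le> sqrt (total_err S)"
  "sqrt (lag_err S) \<le> sqrt (total_err S)"
  using err_nonneg[of S] by (simp_all add: total_err_def)

lemma norm_weights_diff_le: "norm (weights S - wstar) \<le> sqrt (total_err S)"
  using sqrt_err_le_sqrt_total_err(1)[of S] by (simp add: weight_err_def)

lemma norm_deviation_u_table_le: "norm (deviation (u_table S n)) \<le> sqrt (consensus_err S)"
  unfolding consensus_err_def by (intro real_le_rsqrt member_le_sum) auto

lemma norm_lag_le: "norm (lag S n) \<le> sqrt (lag_err S)"
  unfolding lag_err_def by (intro real_le_rsqrt member_le_sum) auto

definition feature_bound :: real where
  "feature_bound = (\<Sum>n\<in>UNIV. norm (h n))"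

lemma feature_bound_nonneg: "0 \<le> feature_bound"
  by (simp add: feature_bound_def sum_nonneg)

lemma norm_feature_le: "norm (h n) \<le> feature_bound"
  unfolding feature_bound_def by (rule member_le_sum) auto

lemma abs_inner_feature_diff_le: "\<bar>h n \<bullet> x - h n \<bullet> y\<bar> \<le> feature_bound * norm (x - y)"
proof -
  have "\<bar>h n \<bullet> x - h n \<bullet> y\<bar> \<le> norm (h n) * norm (x - y)"
    by (metis Cauchy_Schwarz_ineq2 inner_diff_right)
  also have "\<dots> \<le> feature_bound * norm (x - y)"
    by (intro mult_right_mono norm_feature_le) auto
  finally show ?thesis .
qed

lemma u_table_error_le:
  assumes "balanced S"
  shows "\<bar>u_table S n $ k - h n \<bullet> wstar\<bar> \<le> (2 + feature_bound) * sqrt (total_err S)"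
proof -
  have "vec_mean (u_table S n) - h n \<bullet> wstar =
      (h n \<bullet> weights S - h n \<bullet> wstar) - vec_mean (lag S n)"
    using assms by (simp add: balanced_def lag_def vec_mean_diff vec_mean_predictions)
  then have "\<bar>vec_mean (u_table S n) - h n \<bullet> wstar\<bar> \<le>
      feature_bound * norm (weights S - wstar) + norm (lag S n)"
    using abs_vec_mean_le_norm[of "lag S n"] abs_inner_feature_diff_le[of n "weights S" wstar]
    by linarith
  also have "\<dots> \<le> feature_bound * sqrt (total_err S) + sqrt (total_err S)"
    by (intro add_mono mult_left_mono norm_weights_diff_le feature_bound_nonneg
        order_trans[OF norm_lag_le] sqrt_err_le_sqrt_total_err)
  finally show ?thesis
    using abs_component_diff_le[of "u_table S n" k "h n \<bullet> wstar"] norm_deviation_u_table_le[of S n]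
      sqrt_err_le_sqrt_total_err(2)[of S] unfolding distrib_right by linarith
qed

lemma diffused_error_le:
  assumes "balanced S"
  shows "\<bar>diffused S n $ k - h n \<bullet> x\<bar> \<le>
    sqrt (consensus_err S) + sqrt (lag_err S) + feature_bound * norm (weights S - x)"
proof -
  have "norm (deviation (diffused S n)) \<le> 1 * (norm (deviation (u_table S n)) + norm (lag S n))"
    using \<theta> by (intro order_trans[OF norm_deviation_diffused_le] mult_right_mono) auto
  then show ?thesis
    using abs_component_diff_le[of "diffused S n" k "h n \<bullet> x"] norm_deviation_u_table_le[of S n]
      norm_lag_le[of S n] abs_inner_feature_diff_le[of n "weights S" x]
    by (simp add: vec_mean_diffused[OF assms])
qed

lemma diffused_error_wstar_le:
  assumes "balanced S"
  shows "\<bar>diffused S n $ k - h n \<bullet> wstar\<bar> \<le> (2 + feature_bound) * sqrt (total_err S)"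
  using diffused_error_le[OF assms, of n k wstar] sqrt_err_le_sqrt_total_err[of S]
    mult_left_mono[OF norm_weights_diff_le feature_bound_nonneg, of S]
  unfolding distrib_right by linarith

subsection \<open>The update direction\<close>

lemma norm_sample_gradient_diff_le:
  assumes "\<And>k. \<bar>z$k - t\<bar> \<le> B"
  shows "norm (sample_gradient n z - dQ t (\<gamma> n) *\<^sub>R h n) \<le> \<delta> * feature_bound * B"
proof -
  have "0 \<le> B"
    using assms abs_ge_zero order_trans by blast
  have "norm ((sample_gradient n z - dQ t (\<gamma> n) *\<^sub>R h n) $ j) \<le> norm (((\<delta> * B) *\<^sub>R h n) $ j)" for j
  proof -
    have "\<bar>dQ (z $ blk j) (\<gamma> n) - dQ t (\<gamma> n)\<bar> \<le> \<delta> * B"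
      using dQ_lip[of "z $ blk j" n t] mult_left_mono[OF assms[of "blk j"], of \<delta>] \<delta>_pos by linarith
    then have "\<bar>dQ (z $ blk j) (\<gamma> n) - dQ t (\<gamma> n)\<bar> * \<bar>h n $ j\<bar> \<le> \<delta> * B * \<bar>h n $ j\<bar>"
      by (rule mult_right_mono) simp
    then show ?thesis
      using \<delta>_pos \<open>0 \<le> B\<close> by (simp add: sample_gradient_def abs_mult flip: left_diff_distrib)
  qed
  then have "norm (sample_gradient n z - dQ t (\<gamma> n) *\<^sub>R h n) \<le> norm ((\<delta> * B) *\<^sub>R h n)"
    by (rule norm_le_componentwise_cart)
  also have "\<dots> \<le> \<delta> * B * feature_bound"
    using \<delta>_pos \<open>0 \<le> B\<close> by (simp add: mult_left_mono norm_feature_le)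
  finally show ?thesis
    by (simp add: mult_ac)
qed

definition update_gain :: real where
  "update_gain = 2 * (2 * (\<delta> * feature_bound * (2 + feature_bound)) + \<eta>)\<^sup>2"

lemma update_gain_nonneg: "0 \<le> update_gain"
  by (simp add: update_gain_def)

lemma norm_direction_le:
  assumes "balanced S" "balanced S'"
  shows "norm (direction n S S') \<le> (2 * (\<delta> * feature_bound * (2 + feature_bound)) + \<eta>) *
    (sqrt (total_err S) + sqrt (total_err S'))" (is "_ \<le> (2 * ?c + _) * (?y + ?y')")
proof -
  define g where "g = (\<lambda>m. dQ (h m \<bullet> wstar) (\<gamma> m) *\<^sub>R h m)"
  let ?new = "sample_gradient n (diffused S' n) - g n"
    and ?old = "\<lambda>m. sample_gradient m (u_table S m) - g m"
    and ?reg = "(\<Sum>k\<in>UNIV. gr k (weights S)) - (\<Sum>k\<in>UNIV. gr k wstar)"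
  have "average g + (\<Sum>k\<in>UNIV. gr k wstar) = 0"
    using stationary by (simp add: risk_gradient_def g_def)
  then have split: "direction n S S' = ?new - ?old n + average ?old + ?reg"
    by (simp add: direction_def average_diff algebra_simps)
  have new: "norm ?new \<le> ?c * ?y'"
    using norm_sample_gradient_diff_le[OF diffused_error_wstar_le[OF assms(2)]]
    by (simp add: g_def mult.assoc)
  have old: "norm (?old m) \<le> ?c * ?y" for m
    using norm_sample_gradient_diff_le[OF u_table_error_le[OF assms(1)]]
    by (simp add: g_def mult.assoc)
  have reg: "norm ?reg \<le> \<eta> * ?y"
    by (rule order_trans[OF gr_lip]) (intro mult_left_mono norm_weights_diff_le \<eta>_nonneg)
  have "norm (direction n S S') \<le> ?c * ?y' + ?c * ?y + ?c * ?y + \<eta> * ?y"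
    unfolding split
    by (intro norm_triangle_mono[OF norm_triangle_mono[OF norm_triangle_le_diff]] add_mono
        norm_average_le new old reg)
  also have "\<dots> \<le> (2 * ?c + \<eta>) * (?y + ?y')"
    using err_nonneg \<delta>_pos \<eta>_nonneg feature_bound_nonneg by (simp add: distrib_left distrib_right)
  finally show ?thesis .
qed

lemma norm_direction_power2_le:
  assumes "balanced S" "balanced S'"
  shows "(norm (direction n S S'))\<^sup>2 \<le> update_gain * (total_err S + total_err S')"
proof -
  let ?y = "sqrt (total_err S)" and ?y' = "sqrt (total_err S')"
  let ?c = "2 * (\<delta> * feature_bound * (2 + feature_bound)) + \<eta>"
  have "(norm (direction n S S'))\<^sup>2 \<le> (?c * (?y + ?y'))\<^sup>2"
    by (intro power_mono norm_direction_le assms norm_ge_zero)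
  also have "\<dots> = ?c\<^sup>2 * (?y + ?y')\<^sup>2"
    by (rule power_mult_distrib)
  also have "\<dots> \<le> ?c\<^sup>2 * (2 * (total_err S + total_err S'))"
    using Cauchy_Schwarz_ineq[of "(1::real, 1::real)" "(?y, ?y')"] err_nonneg
    by (intro mult_left_mono) simp_all
  finally show ?thesis
    by (simp only: update_gain_def mult_ac)
qed

lemma norm_weights_step_diff_le:
  assumes "balanced S" "balanced S'"
  shows "(norm (weights (step \<mu> n S S') - weights S))\<^sup>2 \<le>
    \<mu>\<^sup>2 * update_gain * (total_err S + total_err S')"
  using mult_left_mono[OF norm_direction_power2_le[OF assms], of "\<mu>\<^sup>2" n]
  by (simp add: weights_step power_mult_distrib mult.assoc)

definition bias_gain :: real where
  "bias_gain = (\<delta> * feature_bound)\<^sup>2 * (2 + feature_bound\<^sup>2)"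

lemma bias_gain_nonneg: "0 \<le> bias_gain"
  by (simp add: bias_gain_def)

lemma norm_bias_le:
  assumes "balanced S'"
  shows "(norm (average (\<lambda>n. direction n S S') - risk_gradient h \<gamma> dQ gr (weights S)))\<^sup>2
    \<le> bias_gain * (consensus_err S' + lag_err S' + (norm (weights S' - weights S))\<^sup>2)"
proof -
  let ?w = "weights S" and ?D = "norm (weights S' - weights S)"
  let ?e = "sqrt (consensus_err S') + sqrt (lag_err S') + feature_bound * ?D"
  \<comment> \<open>averaging over the sample cancels the table entries\<close>
  have "average (\<lambda>n. direction n S S') - risk_gradient h \<gamma> dQ gr ?w =
      average (\<lambda>n. sample_gradient n (diffused S' n) - dQ (h n \<bullet> ?w) (\<gamma> n) *\<^sub>R h n)"
    by (simp add: direction_def risk_gradient_def average_add average_diff)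
  also have "norm \<dots> \<le> \<delta> * feature_bound * ?e"
    by (intro norm_average_le norm_sample_gradient_diff_le diffused_error_le assms)
  finally have "(norm (average (\<lambda>n. direction n S S') - risk_gradient h \<gamma> dQ gr ?w))\<^sup>2
      \<le> (\<delta> * feature_bound * ?e)\<^sup>2"
    by (rule power_mono) simp
  also have "\<dots> = (\<delta> * feature_bound)\<^sup>2 * ?e\<^sup>2"
    by (rule power_mult_distrib)
  also have "\<dots> \<le> (\<delta> * feature_bound)\<^sup>2 *
      ((2 + feature_bound\<^sup>2) * (consensus_err S' + lag_err S' + ?D\<^sup>2))"
    using Cauchy_Schwarz_ineq[of "(1::real, 1::real, feature_bound)"
        "(sqrt (consensus_err S'), sqrt (lag_err S'), ?D)"]
      err_nonneg by (intro mult_left_mono) (simp_all add: add.assoc flip: power2_eq_square)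
  finally show ?thesis
    by (simp only: bias_gain_def mult_ac)
qed

subsection \<open>Expected errors after one step\<close>

lemma neg_two_inner_average_direction_le:
  assumes "balanced S'"
  shows "- 2 * ((weights S - wstar) \<bullet> average (\<lambda>n. direction n S S')) \<le> - \<nu> * weight_err S
    + bias_gain / \<nu> * (consensus_err S' + lag_err S' + (norm (weights S' - weights S))\<^sup>2)"
    (is "_ * (?x \<bullet> ?g) \<le> _ + _ * ?e")
proof -
  let ?G = "risk_gradient h \<gamma> dQ gr (weights S)"
  have "\<nu> * (norm ?x)\<^sup>2 \<le> ?x \<bullet> ?G"
    using risk_gradient_strongly_monotone[of "weights S" wstar]
    by (simp add: stationary inner_commute)
  moreover have "- 2 * (?x \<bullet> (?g - ?G)) \<le> \<nu> * (norm ?x)\<^sup>2 + (norm (?g - ?G))\<^sup>2 / \<nu>"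
    by (rule neg_two_inner_le[OF \<nu>_pos])
  moreover have "(norm (?g - ?G))\<^sup>2 / \<nu> \<le> bias_gain / \<nu> * ?e"
    using divide_right_mono[OF norm_bias_le[OF assms, of S], of \<nu>] \<nu>_pos by simp
  moreover have "?x \<bullet> ?g = ?x \<bullet> ?G + ?x \<bullet> (?g - ?G)"
    by (simp flip: inner_add_right)
  ultimately show ?thesis
    unfolding weight_err_def by linarith
qed

lemma average_weight_err_step:
  assumes "balanced S" "balanced S'" and "0 < \<mu>"
  shows "average (\<lambda>n. weight_err (step \<mu> n S S')) \<le> (1 - \<mu> * \<nu>) * weight_err S
    + \<mu> * (bias_gain / \<nu> * (consensus_err S' + lag_err S' + (norm (weights S' - weights S))\<^sup>2))
    + \<mu>\<^sup>2 * (update_gain * (total_err S + total_err S'))" (is "_ \<le> _ + \<mu> * ?e + _ * ?t")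
proof -
  let ?x = "weights S - wstar" and ?g = "average (\<lambda>n. direction n S S')"
  have "weight_err (step \<mu> n S S') = (norm (?x - \<mu> *\<^sub>R direction n S S'))\<^sup>2" for n
    by (simp add: weight_err_def weights_step algebra_simps)
  then have "average (\<lambda>n. weight_err (step \<mu> n S S')) = weight_err S + \<mu> * (- 2 * (?x \<bullet> ?g))
      + \<mu>\<^sup>2 * average (\<lambda>n. (norm (direction n S S'))\<^sup>2)"
    by (simp add: average_norm_square_step weight_err_def)
  also have "\<dots> \<le> weight_err S + \<mu> * (- \<nu> * weight_err S + ?e) + \<mu>\<^sup>2 * ?t"
    using \<open>0 < \<mu>\<close> assms(1,2)
    by (intro add_mono mult_left_mono neg_two_inner_average_direction_le average_le
        norm_direction_power2_le) auto
  also have "\<dots> = (1 - \<mu> * \<nu>) * weight_err S + \<mu> * ?e + \<mu>\<^sup>2 * ?t"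
    by (simp add: algebra_simps)
  finally show ?thesis .
qed

lemma norm_deviation_diffused_power2_le:
  "(norm (deviation (diffused S n)))\<^sup>2 \<le>
    \<theta> * (norm (deviation (u_table S n)))\<^sup>2 + 1 / (1 - \<theta>) * (norm (lag S n))\<^sup>2"
    (is "_ \<le> \<theta> * ?u\<^sup>2 + _ * ?l\<^sup>2")
proof -
  have t: "1 + (1 - \<theta>) / \<theta> = 1 / \<theta>" "1 + 1 / ((1 - \<theta>) / \<theta>) = 1 / (1 - \<theta>)"
    using \<theta> by (simp_all add: field_simps)
  have "(norm (deviation (diffused S n)))\<^sup>2 \<le> (\<theta> * (?u + ?l))\<^sup>2"
    by (intro power_mono norm_deviation_diffused_le norm_ge_zero)
  also have "\<dots> = \<theta>\<^sup>2 * (?u + ?l)\<^sup>2"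
    by (rule power_mult_distrib)
  also have "\<dots> \<le> \<theta>\<^sup>2 * (1 / \<theta> * ?u\<^sup>2 + 1 / (1 - \<theta>) * ?l\<^sup>2)"
    using norm_add_power2_le[of "(1 - \<theta>) / \<theta>" ?u ?l] \<theta> unfolding t
    by (intro mult_left_mono) simp_all
  also have "\<dots> = \<theta> * ?u\<^sup>2 + \<theta>\<^sup>2 * (1 / (1 - \<theta>) * ?l\<^sup>2)"
    using \<theta> by (simp add: field_simps power2_eq_square)
  also have "\<theta>\<^sup>2 * (1 / (1 - \<theta>) * ?l\<^sup>2) \<le> 1 * (1 / (1 - \<theta>) * ?l\<^sup>2)"
    using \<theta> by (intro mult_right_mono) (auto simp: power_le_one)
  finally show ?thesis
    by simp
qed

lemma average_consensus_err_step:
  "average (\<lambda>n. consensus_err (step \<mu> n S S')) \<le> (1 - 1 / real CARD('n)) * consensus_err S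
    + \<theta> / real CARD('n) * consensus_err S' + 1 / (1 - \<theta>) * lag_err S'"
proof -
  let ?N = "real CARD('n)" and ?z = "\<lambda>n. (norm (deviation (diffused S' n)))\<^sup>2"
  have "consensus_err (step \<mu> n' S S') =
      (\<Sum>n\<in>UNIV. if n = n' then ?z n else (norm (deviation (u_table S n)))\<^sup>2)" for n'
    unfolding consensus_err_def u_table_step by (rule sum.cong) auto
  then have "average (\<lambda>n. consensus_err (step \<mu> n S S')) =
      (1 - 1 / ?N) * consensus_err S + average ?z"
    by (simp only: average_sum_fun_upd) (simp add: consensus_err_def)
  also have "average ?z \<le>
      average (\<lambda>n. \<theta> * (norm (deviation (u_table S' n)))\<^sup>2 + 1 / (1 - \<theta>) * (norm (lag S' n))\<^sup>2)"
    by (intro average_mono norm_deviation_diffused_power2_le)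
  also have "\<dots> = \<theta> / ?N * consensus_err S' + 1 / (1 - \<theta>) * (lag_err S' / ?N)"
    unfolding average_add average_cmult by (simp add: average_def consensus_err_def lag_err_def)
  also have "1 / (1 - \<theta>) * (lag_err S' / ?N) \<le> 1 / (1 - \<theta>) * (lag_err S' / 1)"
    using \<theta> real_card_ge_1[where 'n='n] err_nonneg by (intro mult_left_mono divide_left_mono) auto
  finally show ?thesis
    by simp
qed

definition prediction_bound :: real where
  "prediction_bound = (\<Sum>n\<in>UNIV. onorm (predictions n))"

lemma norm_predictions_power2_le: "(norm (predictions n w))\<^sup>2 \<le> prediction_bound\<^sup>2 * (norm w)\<^sup>2"
proof -
  have bounded: "bounded_linear (predictions n)" for n
    using linear_predictions linear_linear by blast
  have "norm (predictions n w) \<le> onorm (predictions n) * norm w"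
    by (rule onorm[OF bounded])
  also have "\<dots> \<le> prediction_bound * norm w"
    unfolding prediction_bound_def
    by (intro mult_right_mono member_le_sum) (auto intro: onorm_pos_le bounded)
  finally have "(norm (predictions n w))\<^sup>2 \<le> (prediction_bound * norm w)\<^sup>2"
    by (intro power_mono) auto
  then show ?thesis
    by (simp add: power_mult_distrib)
qed

lemma norm_old_lag_power2_le:
  assumes "0 < t" and "(norm (w - weights S))\<^sup>2 \<le> B"
  shows "(norm (predictions n w - v_table S n))\<^sup>2 \<le>
    (1 + t) * (norm (lag S n))\<^sup>2 + (1 + 1 / t) * (prediction_bound\<^sup>2 * B)"
proof -
  have "predictions n w - v_table S n = lag S n + predictions n (w - weights S)"
    by (simp add: lag_def linear_diff[OF linear_predictions])
  then have "(norm (predictions n w - v_table S n))\<^sup>2 \<le>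
      (1 + t) * (norm (lag S n))\<^sup>2 + (1 + 1 / t) * (norm (predictions n (w - weights S)))\<^sup>2"
    using norm_add_power2_le[OF assms(1)] by simp
  also have "(norm (predictions n (w - weights S)))\<^sup>2 \<le> prediction_bound\<^sup>2 * B"
    using norm_predictions_power2_le by (rule order_trans) (intro mult_left_mono assms(2); simp)
  finally show ?thesis
    using assms(1) by (simp add: mult_left_mono)
qed

lemma norm_new_lag_power2_le:
  assumes "(norm (w - weights S))\<^sup>2 \<le> B"
  shows "(norm (predictions n w - predictions n (weights S')))\<^sup>2 \<le>
    2 * prediction_bound\<^sup>2 * (B + (norm (weights S' - weights S))\<^sup>2)"
proof -
  have "(norm (predictions n w - predictions n (weights S')))\<^sup>2 \<le>
      prediction_bound\<^sup>2 * (norm ((w - weights S) + (weights S - weights S')))\<^sup>2"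
    using norm_predictions_power2_le[of n "w - weights S'"]
    by (simp add: linear_diff[OF linear_predictions])
  also have "\<dots> \<le> prediction_bound\<^sup>2 * (2 * (B + (norm (weights S' - weights S))\<^sup>2))"
    using norm_add_power2_le[of 1 "w - weights S" "weights S - weights S'"] assms
    by (intro mult_left_mono) (simp_all add: norm_minus_commute)
  finally show ?thesis
    by (simp only: mult_ac)
qed

definition lag_gain :: real where
  "lag_gain = prediction_bound\<^sup>2 * (real CARD('n) * (1 + 2 * real CARD('n)) + 2)"

lemma lag_gain_nonneg: "0 \<le> lag_gain"
  by (simp add: lag_gain_def)

lemma average_lag_err_step:
  assumes move: "\<And>n. (norm (weights (step \<mu> n S S') - weights S))\<^sup>2 \<le> B"
  shows "average (\<lambda>n. lag_err (step \<mu> n S S')) \<le> (1 - 1 / (2 * real CARD('n))) * lag_err S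
    + lag_gain * (B + (norm (weights S' - weights S))\<^sup>2)"
proof -
  define N where "N = real CARD('n)"
  define p D where "p = prediction_bound\<^sup>2 * B" and "D = (norm (weights S' - weights S))\<^sup>2"
  let ?old = "\<lambda>n. (1 + 1 / (2 * N)) * (norm (lag S n))\<^sup>2 + (1 + 2 * N) * p"
    and ?new = "2 * prediction_bound\<^sup>2 * (B + D)"
  have N: "1 \<le> N"
    unfolding N_def by (rule real_card_ge_1)
  have "0 \<le> B"
    using move zero_le_power2 order_trans by blast
  then have p: "0 \<le> p"
    by (simp add: p_def)
  have "lag_err (step \<mu> n' S S') \<le> (\<Sum>n\<in>UNIV. if n = n' then ?new else ?old n)" for n'
    unfolding lag_err_def
    using norm_old_lag_power2_le[OF _ move, of "1 / (2 * N)" _ n']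
      norm_new_lag_power2_le[OF move, of _ n'] N
    by (intro sum_mono) (auto simp: lag_def v_table_step p_def D_def)
  then have "average (\<lambda>n. lag_err (step \<mu> n S S')) \<le>
      average (\<lambda>n'. \<Sum>n\<in>UNIV. if n = n' then ?new else ?old n)"
    by (rule average_mono)
  also have "\<dots> = (1 - 1 / N) * (\<Sum>n\<in>UNIV. ?old n) + ?new"
    by (simp add: average_sum_fun_upd N_def)
  also have "(\<Sum>n\<in>UNIV. ?old n) = (1 + 1 / (2 * N)) * lag_err S + N * ((1 + 2 * N) * p)"
    by (simp add: sum.distrib lag_err_def N_def flip: sum_distrib_left)
  also have "(1 - 1 / N) * \<dots> =
      (1 - 1 / N) * (1 + 1 / (2 * N)) * lag_err S + (1 - 1 / N) * (N * ((1 + 2 * N) * p))"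
    by (subst distrib_left) (simp only: mult.assoc)
  also have "\<dots> \<le> (1 - 1 / (2 * N)) * lag_err S + 1 * (N * ((1 + 2 * N) * p))"
    using N p err_nonneg by (intro add_mono mult_right_mono) (auto simp: field_simps)
  also have "\<dots> + ?new \<le> (1 - 1 / (2 * N)) * lag_err S + lag_gain * (B + D)"
    using N by (simp add: lag_gain_def N_def p_def D_def algebra_simps)
  finally show ?thesis
    by (simp add: N_def D_def)
qed

subsection \<open>Trajectories\<close>

definition state :: "real \<Rightarrow> (nat \<Rightarrow> 'n) \<Rightarrow> nat \<Rightarrow> ('m,'k,'n) pvrd_state" where
  "state \<mu> ns i = pvrd_hist A blk h \<gamma> dQ gr J \<mu> ns i i"

lemma state_0: "state \<mu> ns 0 = pvrd_init"
  by (simp add: state_def)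

lemma pvrd_hist_eq_state: "i \<le> Suc m \<Longrightarrow> pvrd_hist A blk h \<gamma> dQ gr J \<mu> ns m i = state \<mu> ns i"
proof (induction m)
  case 0
  then show ?case
    by (cases i) (auto simp: state_def Let_def)
next
  case (Suc m)
  then consider "i \<le> Suc m" | "i = Suc (Suc m)"
    by linarith
  then show ?case
    using Suc.IH by cases (simp_all add: state_def Let_def)
qed

lemma state_Suc: "state \<mu> ns (Suc i) =
  (if i < J then state \<mu> ns i else step \<mu> (ns (i - J + 1)) (state \<mu> ns i) (state \<mu> ns (i - J + 1)))"
proof (cases i)
  case 0
  then show ?thesis
    using J_pos pvrd_hist_eq_state[of "Suc 0" 0 \<mu> ns] by (simp add: state_0)
next
  case (Suc m)
  have "state \<mu> ns (Suc i) = pvrd_hist A blk h \<gamma> dQ gr J \<mu> ns i (Suc i)"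
    by (rule pvrd_hist_eq_state[symmetric]) simp
  then show ?thesis
    using Suc J_pos by (simp add: Let_def pvrd_hist_eq_state)
qed

lemma state_warmup: "i < J \<Longrightarrow> state \<mu> ns (Suc i) = state \<mu> ns i"
  and state_update: "J \<le> i \<Longrightarrow>
    state \<mu> ns (Suc i) = step \<mu> (ns (i - J + 1)) (state \<mu> ns i) (state \<mu> ns (i - J + 1))"
  by (subst state_Suc, simp)+

lemma state_induct [case_names init warmup update]:
  assumes init: "P 0"
    and warmup: "\<And>i. \<lbrakk>i < J; P i\<rbrakk> \<Longrightarrow> P (Suc i)"
    and update: "\<And>i. \<lbrakk>J \<le> i; P i; P (i - J + 1)\<rbrakk> \<Longrightarrow> P (Suc i)"
  shows "P i"
proof (induction i rule: less_induct)
  case (less i)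
  consider "i = 0" | j where "i = Suc j" "j < J" | j where "i = Suc j" "J \<le> j"
    by (metis not_less old.nat.exhaust)
  then show ?case
  proof cases
    case 1
    then show ?thesis
      by (simp add: init)
  next
    case 2
    then show ?thesis
      by (simp add: warmup less)
  next
    case 3
    then show ?thesis
      using J_pos by (simp add: update less)
  qed
qed

lemma balanced_state: "balanced (state \<mu> ns i)"
  by (induction i rule: state_induct)
    (simp_all add: state_warmup state_update balanced_step,
      simp add: state_0 balanced_def pvrd_init_def u_table_def v_table_def)

text \<open>The sample drawn at iteration \<open>s\<close> first influences the state at iteration \<open>s + J\<close>, so the
  sample leaving the pipeline at iteration \<open>i\<close> is independent of the state at iteration \<open>i\<close>.\<close>

lemma state_cong: "(\<And>s. \<lbrakk>1 \<le> s; s \<le> i - J\<rbrakk> \<Longrightarrow> ns s = ns' s) \<Longrightarrow> state \<mu> ns i = state \<mu> ns' i"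
proof (induction i rule: state_induct)
  case init
  then show ?case
    by (simp add: state_0)
next
  case (warmup i)
  then show ?case
    by (simp add: state_warmup)
next
  case (update i)
  have "state \<mu> ns i = state \<mu> ns' i" "state \<mu> ns (i - J + 1) = state \<mu> ns' (i - J + 1)"
    using update.hyps J_pos by (intro update.IH update.prems; simp)+
  moreover have "ns (i - J + 1) = ns' (i - J + 1)"
    using update.hyps by (intro update.prems) auto
  ultimately show ?case
    using update.hyps by (simp only: state_update)
qed

lemma blknorm2_le_weight_err:
  "blknorm2 blk k (pvrd_w A blk h \<gamma> dQ gr J \<mu> ns i k) wstar \<le> weight_err (state \<mu> ns i)"
proof -
  have "blknorm2 blk k (pvrd_w A blk h \<gamma> dQ gr J \<mu> ns i k) wstar =
      (\<Sum>j\<in>{j. blk j = k}. ((weights (state \<mu> ns i) - wstar) $ j)\<^sup>2)"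
    by (simp add: blknorm2_def pvrd_w_def weights_def state_def)
  also have "\<dots> \<le> (\<Sum>j\<in>UNIV. ((weights (state \<mu> ns i) - wstar) $ j)\<^sup>2)"
    by (rule sum_mono2) auto
  also have "\<dots> = weight_err (state \<mu> ns i)"
    unfolding weight_err_def power2_norm_eq_inner by (simp add: inner_vec_def power2_eq_square)
  finally show ?thesis .
qed

subsection \<open>Errors along a trajectory\<close>

definition recent_err :: "real \<Rightarrow> (nat \<Rightarrow> 'n) \<Rightarrow> nat \<Rightarrow> real" where
  "recent_err \<mu> ns i = (\<Sum>j\<in>{i - 2 * J..i}. total_err (state \<mu> ns j))"

lemma recent_err_nonneg: "0 \<le> recent_err \<mu> ns i"
  by (simp add: recent_err_def sum_nonneg err_nonneg)

lemma total_err_le_recent_err: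
  "\<lbrakk>i - 2 * J \<le> j; j \<le> i\<rbrakk> \<Longrightarrow> total_err (state \<mu> ns j) \<le> recent_err \<mu> ns i"
  unfolding recent_err_def
  by (rule member_le_sum[of j _ "\<lambda>j. total_err (state \<mu> ns j)"]) (auto simp: err_nonneg)

lemma norm_weights_step_diff_le_recent_err:
  assumes "2 * J \<le> i" and "i - J + 1 \<le> j" "j \<le> i"
  shows "(norm (weights (step \<mu> n (state \<mu> ns j) (state \<mu> ns (j - J + 1)))
    - weights (state \<mu> ns j)))\<^sup>2 \<le> \<mu>\<^sup>2 * (2 * update_gain * recent_err \<mu> ns i)"
proof -
  have "total_err (state \<mu> ns j) + total_err (state \<mu> ns (j - J + 1)) \<le>
      recent_err \<mu> ns i + recent_err \<mu> ns i"
    using assms J_pos by (intro add_mono total_err_le_recent_err) auto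
  then have "\<mu>\<^sup>2 * update_gain * (total_err (state \<mu> ns j) + total_err (state \<mu> ns (j - J + 1))) \<le>
      \<mu>\<^sup>2 * update_gain * (recent_err \<mu> ns i + recent_err \<mu> ns i)"
    using update_gain_nonneg by (intro mult_left_mono) auto
  with norm_weights_step_diff_le[OF balanced_state balanced_state, of \<mu> n \<mu> ns j \<mu> ns "j - J + 1"]
  show ?thesis
    by (simp add: algebra_simps)
qed

lemma norm_weights_delay_le:
  assumes i: "2 * J \<le> i"
  shows "(norm (weights (state \<mu> ns (i - J + 1)) - weights (state \<mu> ns i)))\<^sup>2
    \<le> (real J)\<^sup>2 * (\<mu>\<^sup>2 * (2 * update_gain * recent_err \<mu> ns i))" (is "_ \<le> _ * ?B")
proof -
  let ?s = "i - J + 1" and ?w = "\<lambda>j. weights (state \<mu> ns j)"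
  have "(norm (?w (Suc j) - ?w j))\<^sup>2 \<le> ?B" if "?s \<le> j" "j < i" for j
  proof -
    have "J \<le> j"
      using that i by simp
    then show ?thesis
      using that i by (simp only: state_update) (intro norm_weights_step_diff_le_recent_err; simp)
  qed
  then have "(norm (?w i - ?w ?s))\<^sup>2 \<le> (real (i - ?s))\<^sup>2 * ?B"
    using J_pos i by (intro norm_telescope_power2_le) auto
  also have "\<dots> \<le> (real J)\<^sup>2 * ?B"
    using i update_gain_nonneg recent_err_nonneg by (intro mult_right_mono power_mono) auto
  finally show ?thesis
    by (simp add: norm_minus_commute)
qed

definition loop_gain :: real where
  "loop_gain = 1 / (1 - \<theta>) + bias_gain / \<nu> + 2 * update_gain * (1 + bias_gain / \<nu> * (real J)\<^sup>2)
    + lag_gain * (2 * update_gain * (1 + (real J)\<^sup>2))"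

lemma loop_gain_ge:
  "1 / (1 - \<theta>) \<le> loop_gain" "bias_gain / \<nu> \<le> loop_gain"
  "2 * update_gain * (1 + bias_gain / \<nu> * (real J)\<^sup>2) \<le> loop_gain"
  "lag_gain * (2 * update_gain * (1 + (real J)\<^sup>2)) \<le> loop_gain"
proof -
  have "0 \<le> 1 / (1 - \<theta>)" "0 \<le> bias_gain / \<nu>"
    "0 \<le> 2 * update_gain * (1 + bias_gain / \<nu> * (real J)\<^sup>2)"
    "0 \<le> lag_gain * (2 * update_gain * (1 + (real J)\<^sup>2))"
    using \<theta> \<nu>_pos bias_gain_nonneg update_gain_nonneg lag_gain_nonneg by simp_all
  then show "1 / (1 - \<theta>) \<le> loop_gain" "bias_gain / \<nu> \<le> loop_gain"
    "2 * update_gain * (1 + bias_gain / \<nu> * (real J)\<^sup>2) \<le> loop_gain"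
    "lag_gain * (2 * update_gain * (1 + (real J)\<^sup>2)) \<le> loop_gain"
    unfolding loop_gain_def by linarith+
qed

lemma loop_gain_pos: "0 < loop_gain"
proof -
  have "0 < 1 / (1 - \<theta>)"
    using \<theta> by simp
  then show ?thesis
    using loop_gain_ge(1) by linarith
qed

context
  fixes \<mu> :: real and ns :: "nat \<Rightarrow> 'n" and i :: nat and S S' :: "('m,'k,'n) pvrd_state"
  assumes \<mu>: "0 < \<mu>" "\<mu> \<le> 1" and i: "2 * J \<le> i"
    and S: "S = state \<mu> ns i" and S': "S' = state \<mu> ns (i - J + 1)"
begin

lemma average_weight_err_state: "average (\<lambda>n. weight_err (step \<mu> n S S')) \<le>
  (1 - \<mu> * \<nu>) * weight_err S + \<mu> * loop_gain * (consensus_err S' + lag_err S')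
    + \<mu>\<^sup>2 * loop_gain * recent_err \<mu> ns i"
proof -
  let ?e = "consensus_err S' + lag_err S'" and ?D = "(norm (weights S' - weights S))\<^sup>2"
  define b where "b = bias_gain / \<nu>"
  have b: "0 \<le> b" "b \<le> loop_gain"
    using bias_gain_nonneg \<nu>_pos loop_gain_ge(2) by (simp_all add: b_def)
  have "b * (?e + ?D) \<le> loop_gain * ?e + b * ?D"
    by (subst distrib_left) (intro add_right_mono mult_right_mono b add_nonneg_nonneg err_nonneg)
  then have "\<mu> * (b * (?e + ?D)) \<le> \<mu> * (loop_gain * ?e + b * ?D)"
    using \<mu> by (intro mult_left_mono) auto
  moreover have "\<mu> * (b * ?D) \<le>
      1 * (b * ((real J)\<^sup>2 * (\<mu>\<^sup>2 * (2 * update_gain * recent_err \<mu> ns i))))"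
    using \<mu> b norm_weights_delay_le[OF i] unfolding S S' by (intro mult_mono mult_left_mono) auto
  moreover have "update_gain * (total_err S + total_err S') \<le>
      update_gain * (recent_err \<mu> ns i + recent_err \<mu> ns i)"
    unfolding S S' using i J_pos update_gain_nonneg
    by (intro mult_left_mono add_mono total_err_le_recent_err) auto
  then have "\<mu>\<^sup>2 * (update_gain * (total_err S + total_err S')) \<le>
      \<mu>\<^sup>2 * (2 * update_gain * recent_err \<mu> ns i)"
    by (intro mult_left_mono) simp_all
  moreover have "2 * update_gain * (1 + b * (real J)\<^sup>2) * (\<mu>\<^sup>2 * recent_err \<mu> ns i) \<le>
      loop_gain * (\<mu>\<^sup>2 * recent_err \<mu> ns i)"
    unfolding b_def using recent_err_nonneg by (intro mult_right_mono loop_gain_ge) auto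
  ultimately show ?thesis
    using average_weight_err_step[OF balanced_state balanced_state \<mu>(1), of \<mu> ns i \<mu> ns "i - J + 1"]
    unfolding S[symmetric] S'[symmetric] b_def[symmetric] by (simp add: algebra_simps)
qed

lemma average_consensus_err_state: "average (\<lambda>n. consensus_err (step \<mu> n S S')) \<le>
  (1 - 1 / real CARD('n)) * consensus_err S + \<theta> / real CARD('n) * consensus_err S'
    + loop_gain * lag_err S'"
  by (rule order_trans[OF average_consensus_err_step])
    (intro add_left_mono mult_right_mono loop_gain_ge err_nonneg)

lemma average_lag_err_state: "average (\<lambda>n. lag_err (step \<mu> n S S')) \<le>
  (1 - 1 / (2 * real CARD('n))) * lag_err S + \<mu>\<^sup>2 * loop_gain * recent_err \<mu> ns i"
proof -
  let ?B = "\<mu>\<^sup>2 * (2 * update_gain * recent_err \<mu> ns i)"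
  have "average (\<lambda>n. lag_err (step \<mu> n S S')) \<le> (1 - 1 / (2 * real CARD('n))) * lag_err S
      + lag_gain * (?B + (norm (weights S' - weights S))\<^sup>2)"
    unfolding S S' using i J_pos
    by (intro average_lag_err_step norm_weights_step_diff_le_recent_err) auto
  also have "lag_gain * (?B + (norm (weights S' - weights S))\<^sup>2) \<le>
      lag_gain * (?B + (real J)\<^sup>2 * ?B)"
    unfolding S S' by (intro mult_left_mono add_left_mono norm_weights_delay_le i lag_gain_nonneg)
  also have "\<dots> = lag_gain * (2 * update_gain * (1 + (real J)\<^sup>2)) * (\<mu>\<^sup>2 * recent_err \<mu> ns i)"
    by (simp add: algebra_simps)
  also have "\<dots> \<le> loop_gain * (\<mu>\<^sup>2 * recent_err \<mu> ns i)"
    using recent_err_nonneg by (intro mult_right_mono loop_gain_ge) auto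
  finally show ?thesis
    by (simp add: mult_ac)
qed

end

subsection \<open>Expected errors along a trajectory\<close>

definition expected :: "(('m,'k,'n) pvrd_state \<Rightarrow> real) \<Rightarrow> real \<Rightarrow> nat \<Rightarrow> real" where
  "expected f \<mu> i = expect_paths i (\<lambda>ns. f (state \<mu> ns i))"

lemma expect_paths_state:
  assumes "i - J \<le> m"
  shows "expect_paths m (\<lambda>ns. f (state \<mu> ns i)) = expected f \<mu> i"
proof -
  have "expect_paths m' (\<lambda>ns. f (state \<mu> ns i)) = expect_paths (i - J) (\<lambda>ns. f (state \<mu> ns i))"
    if "i - J \<le> m'" for m'
    using that by (intro expect_paths_eq_of_dependence) (auto intro!: arg_cong[of _ _ f] state_cong)
  from this[OF assms] this[of i] show ?thesis
    by (simp add: expected_def)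
qed

lemma expected_Suc:
  assumes i: "J \<le> i"
  shows "expected f \<mu> (Suc i) =
    expect_paths (i - J) (\<lambda>ns. average (\<lambda>n. f (step \<mu> n (state \<mu> ns i) (state \<mu> ns (i - J + 1)))))"
proof -
  have "state \<mu> (ns(Suc (i - J) := n)) (Suc i) =
      step \<mu> n (state \<mu> ns i) (state \<mu> ns (i - J + 1))" for ns n
  proof -
    have "state \<mu> (ns(Suc (i - J) := n)) i = state \<mu> ns i"
      "state \<mu> (ns(Suc (i - J) := n)) (i - J + 1) = state \<mu> ns (i - J + 1)"
      by (intro state_cong fun_upd_other; use J_pos in arith)+
    then show ?thesis
      using state_update[OF i, of \<mu> "ns(Suc (i - J) := n)"] by simp
  qed
  then show ?thesis
    using expect_paths_state[of "Suc i" "Suc (i - J)" f \<mu>] i by (simp add: expect_paths_Suc)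
qed

lemma expect_paths_recent_err:
  "expect_paths (i - J) (\<lambda>ns. recent_err \<mu> ns i) = (\<Sum>j\<in>{i - 2 * J..i}.
    expected weight_err \<mu> j + expected consensus_err \<mu> j + expected lag_err \<mu> j)"
  by (simp add: recent_err_def total_err_def expect_paths_sum expect_paths_add
      expect_paths_state diff_le_mono)

lemma delayed_recursion_expected_err:
  assumes \<mu>: "0 < \<mu>" "\<mu> \<le> 1"
  shows "delayed_recursion J (real CARD('n)) loop_gain \<theta> \<nu> \<mu>
    (expected weight_err \<mu>) (expected consensus_err \<mu>) (expected lag_err \<mu>)"
  unfolding delayed_recursion_def Let_def
proof (intro allI impI)
  fix i assume i: "2 * J \<le> i"
  then have "i - J + 1 \<le> i"
    using J_pos by simp
  then have E: "expect_paths (i - J) (\<lambda>ns. f (state \<mu> ns i)) = expected f \<mu> i"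
    "expect_paths (i - J) (\<lambda>ns. f (state \<mu> ns (i - J + 1))) = expected f \<mu> (i - J + 1)" for f
    by (simp_all only: expect_paths_state diff_le_mono order_refl)
  have E_Suc: "expected f \<mu> (Suc i) \<le> expect_paths (i - J) g"
    if "\<And>ns. average (\<lambda>n. f (step \<mu> n (state \<mu> ns i) (state \<mu> ns (i - J + 1)))) \<le> g ns" for f g
    using i that by (simp add: expected_Suc expect_paths_mono)
  show "expected weight_err \<mu> (Suc i) \<le> (1 - \<mu> * \<nu>) * expected weight_err \<mu> i
        + \<mu> * loop_gain * (expected consensus_err \<mu> (i - J + 1) + expected lag_err \<mu> (i - J + 1))
        + \<mu>\<^sup>2 * loop_gain * (\<Sum>j\<in>{i - 2 * J..i}.
          expected weight_err \<mu> j + expected consensus_err \<mu> j + expected lag_err \<mu> j) \<and>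
      expected consensus_err \<mu> (Suc i) \<le> (1 - 1 / real CARD('n)) * expected consensus_err \<mu> i
        + \<theta> / real CARD('n) * expected consensus_err \<mu> (i - J + 1)
        + loop_gain * expected lag_err \<mu> (i - J + 1) \<and>
      expected lag_err \<mu> (Suc i) \<le> (1 - 1 / (2 * real CARD('n))) * expected lag_err \<mu> i
        + \<mu>\<^sup>2 * loop_gain * (\<Sum>j\<in>{i - 2 * J..i}.
          expected weight_err \<mu> j + expected consensus_err \<mu> j + expected lag_err \<mu> j)"
    using E_Suc[OF average_weight_err_state[OF \<mu> i refl refl]]
      E_Suc[OF average_consensus_err_state[OF \<mu> i refl refl]]
      E_Suc[OF average_lag_err_state[OF \<mu> i refl refl]]
    unfolding expect_paths_add expect_paths_cmult expect_paths_recent_err E by blast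
qed

abbreviation "expected_block_err \<mu> k i \<equiv>
  expect_paths i (\<lambda>ns. blknorm2 blk k (pvrd_w A blk h \<gamma> dQ gr J \<mu> ns i k) wstar)"

lemma eventually_expected_block_err_le:
  assumes rate: "\<And>\<mu>. 1 - \<mu> * \<nu> / 5 \<le> \<rho> \<mu>"
  shows "\<forall>\<^sub>F \<mu> in at_right 0. \<exists>C. \<forall>k i. expected_block_err \<mu> k i \<le> \<rho> \<mu> ^ i * C"
proof -
  obtain \<beta> \<kappa> q where "\<forall>\<^sub>F \<mu> in at_right 0. decay_weights J (real CARD('n)) loop_gain \<theta> \<nu> \<mu> \<beta> \<kappa> q"
    using eventually_decay_weights[OF real_card_ge_1 loop_gain_pos \<theta> \<nu>_pos] .
  moreover have "\<forall>\<^sub>F \<mu> in at_right 0. \<mu> < (1::real)"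
    by (intro eventually_at_right_less_of_isCont) auto
  ultimately show ?thesis
  proof eventually_elim
    fix \<mu> :: real
    assume weights: "decay_weights J (real CARD('n)) loop_gain \<theta> \<nu> \<mu> \<beta> \<kappa> q" and "\<mu> < 1"
    then have \<mu>: "0 < \<mu>" "\<mu> \<le> 1" "\<mu> * \<nu> < 1"
      by (auto simp: decay_weights_def Let_def)
    then obtain C where C: "0 \<le> C" "\<And>i. expected weight_err \<mu> i \<le> C * (1 - \<mu> * \<nu> / 5) ^ i"
      using delayed_recursion_decay[OF J_pos real_card_ge_1 _ _ \<nu>_pos weights
          delayed_recursion_expected_err] loop_gain_pos \<theta> by (metis less_imp_le)
    have "expected_block_err \<mu> k i \<le> \<rho> \<mu> ^ i * C" for k i
    proof -
      have "expected_block_err \<mu> k i \<le> expected weight_err \<mu> i"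
        unfolding expected_def by (intro expect_paths_mono blknorm2_le_weight_err)
      also have "\<dots> \<le> C * (1 - \<mu> * \<nu> / 5) ^ i"
        by (rule C)
      also have "\<dots> \<le> C * \<rho> \<mu> ^ i"
        using C(1) \<mu>(3) rate by (intro mult_left_mono power_mono) auto
      finally show ?thesis
        by (simp add: mult.commute)
    qed
    then show "\<exists>C. \<forall>k i. expected_block_err \<mu> k i \<le> \<rho> \<mu> ^ i * C"
      by blast
  qed
qed

lemma expected_block_err_linear_rate:
  assumes "\<And>\<mu>. 1 - \<mu> * \<nu> / 5 \<le> \<rho> \<mu>"
  shows "\<exists>\<mu>bar>0. \<forall>\<mu>. 0 < \<mu> \<and> \<mu> \<le> \<mu>bar \<longrightarrow>
    (\<exists>C. \<forall>k. \<forall>i>0. expected_block_err \<mu> k i \<le> \<rho> \<mu> ^ i * C)"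
proof -
  obtain b where "0 < b" and bound:
    "\<And>\<mu>. \<lbrakk>0 < \<mu>; \<mu> < b\<rbrakk> \<Longrightarrow> \<exists>C. \<forall>k i. expected_block_err \<mu> k i \<le> \<rho> \<mu> ^ i * C"
    using eventually_expected_block_err_le[OF assms] unfolding eventually_at_right_field by blast
  show ?thesis
  proof (rule exI[of _ "b / 2"], intro conjI allI impI)
    fix \<mu> assume "0 < \<mu> \<and> \<mu> \<le> b / 2"
    then have "0 < \<mu>" "\<mu> < b"
      using \<open>0 < b\<close> by auto
    then show "\<exists>C. \<forall>k. \<forall>i>0. expected_block_err \<mu> k i \<le> \<rho> \<mu> ^ i * C"
      using bound by blast
  qed (use \<open>0 < b\<close> in simp)
qed

end

theorem theorem1:
  fixes h :: "'n::finite \<Rightarrow> real^'m::finite"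
    and \<gamma> :: "'n \<Rightarrow> real"
    and blk :: "'m \<Rightarrow> 'k::finite"
    and Q dQ :: "real \<Rightarrow> real \<Rightarrow> real"
    and r :: "'k \<Rightarrow> real^'m \<Rightarrow> real"
    and gr :: "'k \<Rightarrow> real^'m \<Rightarrow> real^'m"
    and A :: "real^'k^'k"
    and E :: "'k \<Rightarrow> 'k \<Rightarrow> bool"
    and L \<delta> \<eta> \<nu> :: real
    and wstar :: "real^'m"
    and J :: nat
  assumes K2: "CARD('k) \<ge> 2"
    and Q_deriv: "\<And>z g. ((\<lambda>z. Q z g) has_real_derivative dQ z g) (at z)"
    and L_pos: "L > 0" and \<delta>_pos: "\<delta> > 0"
    and Q_lip: "\<And>n w1 w2. norm (dQ (h n \<bullet> w1) (\<gamma> n) *\<^sub>R h n - dQ (h n \<bullet> w2) (\<gamma> n) *\<^sub>R h n)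
                   \<le> L * norm (w1 - w2)"
    and dQ_lip: "\<And>n z1 z2. \<bar>dQ z1 (\<gamma> n) - dQ z2 (\<gamma> n)\<bar> \<le> \<delta> * \<bar>z1 - z2\<bar>"
    and r_block: "\<And>k x y. (\<forall>j. blk j = k \<longrightarrow> x$j = y$j) \<Longrightarrow> r k x = r k y"
    and r_deriv: "\<And>k x. (r k has_derivative (\<lambda>d. gr k x \<bullet> d)) (at x)"
    and r_convex: "convex_on UNIV (\<lambda>w. \<Sum>k\<in>UNIV. r k w)"
    and \<eta>_nonneg: "\<eta> \<ge> 0"
    and r_lip: "\<And>x y. norm ((\<Sum>k\<in>UNIV. gr k x) - (\<Sum>k\<in>UNIV. gr k y)) \<le> \<eta> * norm (x - y)"
    and \<nu>_pos: "\<nu> > 0"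
    and R_strong: "\<And>w1 w2.
          (((1 / real CARD('n)) *\<^sub>R (\<Sum>n\<in>UNIV. dQ (h n \<bullet> w1) (\<gamma> n) *\<^sub>R h n) + (\<Sum>k\<in>UNIV. gr k w1))
         - ((1 / real CARD('n)) *\<^sub>R (\<Sum>n\<in>UNIV. dQ (h n \<bullet> w2) (\<gamma> n) *\<^sub>R h n) + (\<Sum>k\<in>UNIV. gr k w2)))
          \<bullet> (w1 - w2) \<ge> \<nu> * (norm (w1 - w2))\<^sup>2"
    and wstar_min: "\<And>w. (1 / real CARD('n)) * (\<Sum>n\<in>UNIV. Q (h n \<bullet> wstar) (\<gamma> n)) + (\<Sum>k\<in>UNIV. r k wstar)
                     \<le> (1 / real CARD('n)) * (\<Sum>n\<in>UNIV. Q (h n \<bullet> w) (\<gamma> n)) + (\<Sum>k\<in>UNIV. r k w)"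
    and E_conn: "\<And>k l. E\<^sup>*\<^sup>* k l"
    and A_nonneg: "\<And>l k. A$l$k \<ge> 0"
    and A_support: "\<And>l k. A$l$k > 0 \<Longrightarrow> l = k \<or> E l k"
    and A_sym: "transpose A = A"
    and A_stoch: "A *v (\<chi> k. 1) = (\<chi> k. 1)"
    and A_diag: "\<exists>k. A$k$k > 0"
    and lam_range: "0 < second_largest_eig_mag A" "second_largest_eig_mag A < 1"
    and J_pos: "J \<ge> 1"
  shows "\<exists>\<mu>bar>0. \<forall>\<mu>. 0 < \<mu> \<and> \<mu> \<le> \<mu>bar \<longrightarrow>
           (\<exists>C. \<forall>k. \<forall>i>0.
              expect_paths i (\<lambda>ns. blknorm2 blk k (pvrd_w A blk h \<gamma> dQ gr J \<mu> ns i k) wstar)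
              \<le> (max (1 - (1 - second_largest_eig_mag A ^ J) / (2 * real CARD('n)))
                      (1 - \<mu> * \<nu> / 5)) ^ i * C)"
proof -
  have stoch: "A *v 1 = 1"
    using A_stoch by (simp add: one_vec_def)
  obtain \<theta> where \<theta>: "0 < \<theta>" "\<theta> < 1" "\<And>z. 1 \<bullet> z = 0 \<Longrightarrow> norm (A *v z) \<le> \<theta> * norm z"
    using symmetric_stochastic_contraction[OF A_sym stoch lam_range(2)] by blast
  have stationary: "risk_gradient h \<gamma> dQ gr wstar = 0"
    by (rule gradient_eq_0_at_minimum[OF risk_has_derivative[OF Q_deriv r_deriv]])
      (use wstar_min in \<open>simp add: risk_def average_def\<close>)
  have strongly_monotone: "\<nu> * (norm (w1 - w2))\<^sup>2 \<le>
      (risk_gradient h \<gamma> dQ gr w1 - risk_gradient h \<gamma> dQ gr w2) \<bullet> (w1 - w2)" for w1 w2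
    unfolding risk_gradient_def average_def by (rule R_strong)
  have gr_local: "gr k x = gr k y" if "\<And>j. blk j = k \<Longrightarrow> x$j = y$j" for k x y
    by (rule gradient_cong_on_coordinates[where P = "\<lambda>j. blk j = k", OF r_deriv r_block that])
  have gr_support: "gr k x $ j = 0" if "blk j \<noteq> k" for k x j
    by (rule gradient_nth_eq_0[where P = "\<lambda>j. blk j = k", OF r_deriv r_block that])
  interpret pvrd A blk h \<gamma> dQ gr J \<delta> \<eta> \<nu> \<theta> wstar
    by unfold_locales (fact \<delta>_pos \<eta>_nonneg \<nu>_pos J_pos \<theta> dQ_lip gr_support gr_local r_lip
        strongly_monotone stationary A_sym stoch)+
  show ?thesis
    by (rule expected_block_err_linear_rate) simp
qed

end
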